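(* The operator $\Xi$ preserves the space of symmetric polynomials and maps $J_\lambda^{(\alpha)}$ to $J_\lambda^{r\delta}$ for every partition $\lambda$. Moreover, if $f$ is homogeneous symmetric of degree $d$, then $g=\Xi(f)$ is the unique polynomial such that (1) $g$ is symmetric, (2) $g-f$ has degree $<d$, and (3) $g(-\mu-r\delta)=0$ for all partitions $\mu$ with $|\mu|<d$.
   Context: Fix $n\ge1$; $r$ is an indeterminate, $\alpha=1/r$, $\mathbb{F}=\mathbb{Q}(r)$, polynomials in $\mathbb{F}[x_1,\dots,x_n]$. Compositions are $\eta\in\mathbb{N}^n$, $|\eta|=\sum\eta_i$; partitions are weakly decreasing compositions; $\delta=(n-1,\dots,0)$; permutations act on vectors by $(wv)_{w(i)}=v_i$; $w_\gamma$ is the minimal-length permutation with $w_\gamma^{-1}(\gamma)$ a partition, $\overline\gamma=\gamma+w_\gamma(r\delta)$. $E_\eta^{r\delta}$ is the unique polynomial of degree $|\eta|$ vanishing at all $\overline\gamma$ with $\gamma\ne\eta$, $|\gamma|\le|\eta|$, with coefficient $1$ on $x^\eta$; $E_\eta^{(\alpha)}$ its top homogeneous component. With $a_\eta(i,j)=\eta_i-j$, $l_\eta(i,j)=\#\{k>i:j\le\eta_k\le\eta_i\}+\#\{k<i:j\le\eta_k+1\le\eta_i\}$, $d_\eta(\alpha)=\prod_{1\le j\le\eta_i}(\alpha(a_\eta(i,j)+1)+l_\eta(i,j)+1)$, set $F_\eta^{(\alpha)}=d_\eta E_\eta^{(\alpha)}$, $F_\eta^{r\delta}(x)=(-1)^{|\eta|}d_\eta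 E_\eta^{r\delta}(-x)$; $\Xi$ is the unique $\mathbb{F}$-linear operator with $\Xi(F_\eta^{(\alpha)})=F_\eta^{r\delta}$ for all $\eta$. $P_\lambda^{r\delta}$ is the unique symmetric polynomial of degree $|\lambda|$ with $P_\lambda^{r\delta}(\mu+r\delta)=0$ for partitions $\mu\ne\lambda$, $|\mu|\le|\lambda|$, and coefficient $1$ on $m_\lambda$; $P_\lambda^{(\alpha)}$ is the Jack polynomial, equal to the top homogeneous component of $P_\lambda^{r\delta}$. For a partition $\lambda$ and box $(i,j)$ ($1\le j\le\lambda_i$) let $a_\lambda(i,j)=\lambda_i-j$, $l_\lambda(i,j)=\#\{k>i:\lambda_k\ge j\}$, $c_\lambda(\alpha)=\prod_s(\alpha a_\lambda(s)+l_\lambda(s)+1)$; $J_\lambda^{(\alpha)}=c_\lambda(\alpha)P_\lambda^{(\alpha)}$ and $J_\lambda^{r\delta}(x)=(-1)^{|\lambda|}c_\lambda(\alpha)P_\lambda^{r\delta}(-x)$. *)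

theory Defs
  imports
    "HOL-Computational_Algebra.Polynomial"
    "HOL-Computational_Algebra.Fraction_Field"
    "HOL-Combinatorics.Permutations"
    "HOL-Library.Poly_Mapping"
    "HOL-Library.FuncSet"
begin

section \<open>The coefficient field \<open>\<rat>(r)\<close>\<close>

type_synonym ratfun = "rat poly fract"

definition r :: ratfun where
  "r = Fract [:0, 1:] 1"

definition \<alpha> :: ratfun where
  "\<alpha> = 1 / r"

section \<open>Compositions, partitions and polynomials in \<open>x\<^sub>1, \<dots>, x\<^sub>n\<close>\<close>

text \<open>
  A vector in \<open>\<nat>\<^sup>n\<close> is a finitely supported map on \<open>nat\<close> whose support lies in \<open>{1..n}\<close>, so that
  compositions and exponent vectors are the same objects. A polynomial maps exponent vectors
  to coefficients.
\<close>

abbreviation lookup :: "('a \<Rightarrow>\<^sub>0 'b::zero) \<Rightarrow> 'a \<Rightarrow> 'b" where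
  "lookup \<equiv> Poly_Mapping.lookup"

abbreviation keys :: "('a \<Rightarrow>\<^sub>0 'b::zero) \<Rightarrow> 'a set" where
  "keys \<equiv> Poly_Mapping.keys"

type_synonym expvec = "nat \<Rightarrow>\<^sub>0 nat"
type_synonym mpol = "expvec \<Rightarrow>\<^sub>0 ratfun"

definition compositions :: "nat \<Rightarrow> expvec set" where
  "compositions n = {\<eta>. keys \<eta> \<subseteq> {1..n}}"

definition partitions :: "nat \<Rightarrow> expvec set" where
  "partitions n = {\<mu> \<in> compositions n.
     \<forall>i\<in>{1..n}. \<forall>j\<in>{1..n}. i \<le> j \<longrightarrow> lookup \<mu> j \<le> lookup \<mu> i}"

definition weight :: "expvec \<Rightarrow> nat" where
  "weight \<eta> = (\<Sum>i\<in>keys \<eta>. lookup \<eta> i)"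

definition mpols :: "nat \<Rightarrow> mpol set" where
  "mpols n = {p. keys p \<subseteq> compositions n}"

definition scale :: "ratfun \<Rightarrow> mpol \<Rightarrow> mpol" where
  "scale c p = Poly_Mapping.map ((*) c) p"

definition evalp :: "mpol \<Rightarrow> (nat \<Rightarrow> ratfun) \<Rightarrow> ratfun" where
  "evalp p v = (\<Sum>m\<in>keys p. lookup p m * (\<Prod>i\<in>keys m. v i ^ lookup m i))"

text \<open>The total degree; the zero polynomial gets the value 0.\<close>

definition tdeg :: "mpol \<Rightarrow> nat" where
  "tdeg p = Max (insert 0 (weight ` keys p))"

text \<open>In a strict degree bound the zero polynomial counts as having degree \<open>-\<infinity>\<close>.\<close>

definition deg_less :: "mpol \<Rightarrow> nat \<Rightarrow> bool" where
  "deg_less p d \<longleftrightarrow> p = 0 \<or> tdeg p < d"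

definition homogeneous :: "nat \<Rightarrow> mpol \<Rightarrow> bool" where
  "homogeneous d p \<longleftrightarrow> (\<forall>m\<in>keys p. weight m = d)"

definition top_part :: "mpol \<Rightarrow> mpol" where
  "top_part p = (\<Sum>m\<in>{m \<in> keys p. weight m = tdeg p}. Poly_Mapping.single m (lookup p m))"

text \<open>The polynomial \<open>p(-x)\<close>.\<close>

definition reflect_vars :: "mpol \<Rightarrow> mpol" where
  "reflect_vars p = (\<Sum>m\<in>keys p. Poly_Mapping.single m ((-1) ^ weight m * lookup p m))"

text \<open>
  Permuting the variables of a polynomial permutes the entries of its exponent vectors, and
  \<open>Poly_Mapping.map_key w m\<close> is \<open>m \<circ> w\<close>.
\<close>

definition sym_mpols :: "nat \<Rightarrow> mpol set" where
  "sym_mpols n = {p \<in> mpols n.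
     \<forall>w. w permutes {1..n} \<longrightarrow> (\<forall>m. lookup p (Poly_Mapping.map_key w m) = lookup p m)}"

section \<open>The interpolation points\<close>

text \<open>The action \<open>(w v)\<^bsub>w(i)\<^esub> = v\<^sub>i\<close> on vectors.\<close>

definition perm_act :: "(nat \<Rightarrow> nat) \<Rightarrow> (nat \<Rightarrow> 'a) \<Rightarrow> nat \<Rightarrow> 'a" where
  "perm_act w v = v \<circ> inv w"

text \<open>The length of a permutation is its number of inversions.\<close>

definition perm_length :: "nat \<Rightarrow> (nat \<Rightarrow> nat) \<Rightarrow> nat" where
  "perm_length n w = card {(i, j). i \<in> {1..n} \<and> j \<in> {1..n} \<and> i < j \<and> w j < w i}"

definition sort_perm :: "nat \<Rightarrow> expvec \<Rightarrow> nat \<Rightarrow> nat" where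
  "sort_perm n \<gamma> = arg_min (perm_length n)
     (\<lambda>w. w permutes {1..n} \<and>
       (\<exists>\<mu>\<in>partitions n. lookup \<mu> = perm_act (inv w) (lookup \<gamma>)))"

text \<open>
  The vector \<open>r \<delta>\<close> with \<open>\<delta> = (n - 1, \<dots>, 0)\<close>. Its values outside \<open>{1..n}\<close> are never used.
\<close>

definition r_delta :: "nat \<Rightarrow> nat \<Rightarrow> ratfun" where
  "r_delta n i = r * of_nat (n - i)"

text \<open>The point \<open>\<gamma> + w\<^sub>\<gamma>(r \<delta>)\<close>.\<close>

definition bar :: "nat \<Rightarrow> expvec \<Rightarrow> nat \<Rightarrow> ratfun" where
  "bar n \<gamma> i = of_nat (lookup \<gamma> i) + perm_act (sort_perm n \<gamma>) (r_delta n) i"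

section \<open>Nonsymmetric interpolation polynomials and the operator \<open>\<Xi>\<close>\<close>

definition boxes :: "nat \<Rightarrow> expvec \<Rightarrow> (nat \<times> nat) set" where
  "boxes n \<eta> = (SIGMA i:{1..n}. {1..lookup \<eta> i})"

definition arm :: "expvec \<Rightarrow> nat \<Rightarrow> nat \<Rightarrow> nat" where
  "arm \<eta> i j = lookup \<eta> i - j"

definition leg :: "nat \<Rightarrow> expvec \<Rightarrow> nat \<Rightarrow> nat \<Rightarrow> nat" where
  "leg n \<eta> i j =
     card {k \<in> {1..n}. k > i \<and> j \<le> lookup \<eta> k \<and> lookup \<eta> k \<le> lookup \<eta> i} +
     card {k \<in> {1..n}. k < i \<and> j \<le> lookup \<eta> k + 1 \<and> lookup \<eta> k + 1 \<le> lookup \<eta> i}"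

definition d_factor :: "nat \<Rightarrow> expvec \<Rightarrow> ratfun" where
  "d_factor n \<eta> =
     (\<Prod>(i, j)\<in>boxes n \<eta>. \<alpha> * of_nat (arm \<eta> i j + 1) + of_nat (leg n \<eta> i j) + 1)"

text \<open>\<open>E\<^sub>\<eta>\<close> with superscript \<open>r \<delta>\<close>, followed by its top homogeneous component.\<close>

definition E_int :: "nat \<Rightarrow> expvec \<Rightarrow> mpol" where
  "E_int n \<eta> = (THE p. p \<in> mpols n \<and> tdeg p = weight \<eta> \<and>
     (\<forall>\<gamma>\<in>compositions n. \<gamma> \<noteq> \<eta> \<and> weight \<gamma> \<le> weight \<eta> \<longrightarrow> evalp p (bar n \<gamma>) = 0) \<and>
     lookup p \<eta> = 1)"

definition E_top :: "nat \<Rightarrow> expvec \<Rightarrow> mpol" where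
  "E_top n \<eta> = top_part (E_int n \<eta>)"

definition F_top :: "nat \<Rightarrow> expvec \<Rightarrow> mpol" where
  "F_top n \<eta> = scale (d_factor n \<eta>) (E_top n \<eta>)"

definition F_int :: "nat \<Rightarrow> expvec \<Rightarrow> mpol" where
  "F_int n \<eta> = scale ((-1) ^ weight \<eta> * d_factor n \<eta>) (reflect_vars (E_int n \<eta>))"

definition linear_operator :: "nat \<Rightarrow> (mpol \<Rightarrow> mpol) \<Rightarrow> bool" where
  "linear_operator n T \<longleftrightarrow> T \<in> mpols n \<rightarrow> mpols n \<and>
     (\<forall>p\<in>mpols n. \<forall>q\<in>mpols n. T (p + q) = T p + T q) \<and>
     (\<forall>c. \<forall>p\<in>mpols n. T (scale c p) = scale c (T p))"

text \<open>
  \<open>extensional\<close> only fixes the irrelevant values outside the polynomials in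
  \<open>x\<^sub>1, \<dots>, x\<^sub>n\<close>, which is needed for uniqueness as a HOL function.
\<close>

definition Xi :: "nat \<Rightarrow> mpol \<Rightarrow> mpol" where
  "Xi n = (THE T. T \<in> extensional (mpols n) \<and> linear_operator n T \<and>
     (\<forall>\<eta>\<in>compositions n. T (F_top n \<eta>) = F_int n \<eta>))"

section \<open>Symmetric interpolation polynomials and Jack polynomials\<close>

text \<open>
  The coefficient of the monomial symmetric polynomial \<open>m\<^sub>\<kappa>\<close> in a symmetric polynomial is its
  coefficient on \<open>x\<^sup>\<kappa>\<close>.
\<close>

definition P_int :: "nat \<Rightarrow> expvec \<Rightarrow> mpol" where
  "P_int n \<kappa> = (THE p. p \<in> sym_mpols n \<and> tdeg p = weight \<kappa> \<and>
     (\<forall>\<mu>\<in>partitions n. \<mu> \<noteq> \<kappa> \<and> weight \<mu> \<le> weight \<kappa> \<longrightarrow>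
        evalp p (\<lambda>i. of_nat (lookup \<mu> i) + r_delta n i) = 0) \<and>
     lookup p \<kappa> = 1)"

text \<open>
  The Jack polynomial \<open>P\<^sub>\<kappa>\<close> with parameter \<open>\<alpha>\<close> (coefficient 1 on \<open>m\<^sub>\<kappa>\<close>), taken as the top
  homogeneous component of the interpolation polynomial, in parallel with \<open>E_top\<close>.
\<close>

definition P_jack :: "nat \<Rightarrow> expvec \<Rightarrow> mpol" where
  "P_jack n \<kappa> = top_part (P_int n \<kappa>)"

definition partition_leg :: "nat \<Rightarrow> expvec \<Rightarrow> nat \<Rightarrow> nat \<Rightarrow> nat" where
  "partition_leg n \<kappa> i j = card {k \<in> {1..n}. k > i \<and> lookup \<kappa> k \<ge> j}"

definition c_factor :: "nat \<Rightarrow> expvec \<Rightarrow> ratfun" where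
  "c_factor n \<kappa> =
     (\<Prod>(i, j)\<in>boxes n \<kappa>. \<alpha> * of_nat (arm \<kappa> i j) + of_nat (partition_leg n \<kappa> i j) + 1)"

definition J_jack :: "nat \<Rightarrow> expvec \<Rightarrow> mpol" where
  "J_jack n \<kappa> = scale (c_factor n \<kappa>) (P_jack n \<kappa>)"

definition J_int :: "nat \<Rightarrow> expvec \<Rightarrow> mpol" where
  "J_int n \<kappa> = scale ((-1) ^ weight \<kappa> * c_factor n \<kappa>) (reflect_vars (P_int n \<kappa>))"

end

theory Submission
  imports Defs "HOL-Computational_Algebra.Polynomial_Factorial"
begin

text \<open>
  On a homogeneous \<open>f\<close> of degree \<open>d\<close>, the polynomial \<open>g = \<Xi>(f)\<close> is determined by
  \<open>deg (g - f) < d\<close> and \<open>g(-bar \<gamma>) = 0\<close> for all compositions with \<open>|\<gamma>| < d\<close>, because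
  \<open>F\<^sub>\<eta>\<close> with superscript \<open>r \<delta>\<close> has these properties relative to its top component. Since
  \<open>bar \<gamma>\<close> is a rearrangement of \<open>\<gamma>\<^sup>+ + r \<delta>\<close>, where \<open>\<gamma>\<^sup>+\<close> is the sorted \<open>\<gamma>\<close>, a symmetric \<open>g\<close>
  only has to vanish at the points \<open>-\<mu> - r \<delta>\<close>, and symmetric interpolation provides such a
  \<open>g\<close> when \<open>f\<close> is symmetric. Unique solvability of all interpolation problems, including that
  the leading coefficients can be normalised to 1, follows by specialising to \<open>r = 0\<close>, where
  the nodes form the grid \<open>\<nat>\<^sup>n\<close> and finite differences apply.
\<close>

section \<open>Square linear systems\<close>

text \<open>Gaussian elimination by induction on the equations \<open>S\<close>: an equation with
  all coefficients zero is dropped; otherwise it is solved for a pivot unknown \<open>u\<close>,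
  which is eliminated from the other equations.\<close>

lemma underdetermined_system:
  fixes a :: "'a \<Rightarrow> 'b \<Rightarrow> 'f::field"
  assumes "finite S" "finite T" "card S < card T"
  shows "\<exists>c. (\<exists>t\<in>T. c t \<noteq> 0) \<and> (\<forall>s\<in>S. (\<Sum>t\<in>T. a s t * c t) = 0)"
  using assms
proof (induction S arbitrary: T a rule: finite_induct)
  case empty
  then obtain t where "t \<in> T" by fastforce
  then show ?case by (intro exI[of _ "\<lambda>_. 1"]) auto
next
  case (insert s S)
  show ?case
  proof (cases "\<forall>t\<in>T. a s t = 0")
    case True
    have "card S < card T" using insert.hyps insert.prems by simp
    then obtain c where "\<exists>t\<in>T. c t \<noteq> 0" "\<forall>s\<in>S. (\<Sum>t\<in>T. a s t * c t) = 0"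
      using insert.IH[of T a] insert.prems by blast
    moreover have "(\<Sum>t\<in>T. a s t * c t) = 0" using True by simp
    ultimately show ?thesis by (intro exI[of _ c]) simp
  next
    case False
    then obtain u where u: "u \<in> T" "a s u \<noteq> 0" by auto
    define T' where "T' = T - {u}"
    have T: "T = insert u T'" "u \<notin> T'" "finite T'"
      using u insert.prems by (auto simp: T'_def)
    have "card S < card T'" using insert T by auto
    from insert.IH[OF \<open>finite T'\<close> this, of "\<lambda>z t. a z t - a z u * a s t / a s u"]
    obtain c where c: "\<exists>t\<in>T'. c t \<noteq> 0"
      "\<forall>z\<in>S. (\<Sum>t\<in>T'. (a z t - a z u * a s t / a s u) * c t) = 0" by blast
    define c' where "c' = c(u := - (\<Sum>t\<in>T'. a s t * c t) / a s u)"
    have split: "(\<Sum>t\<in>T. a z t * c' t) = a z u * c' u + (\<Sum>t\<in>T'. a z t * c t)" for z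
    proof -
      have "(\<Sum>t\<in>T'. a z t * c' t) = (\<Sum>t\<in>T'. a z t * c t)"
        using T by (intro sum.cong) (auto simp: c'_def)
      then show ?thesis using T by simp
    qed
    have "(\<Sum>t\<in>T. a z t * c' t) = (\<Sum>t\<in>T'. (a z t - a z u * a s t / a s u) * c t)" for z
      unfolding split
      by (simp add: c'_def algebra_simps sum_subtractf sum_distrib_left sum_divide_distrib)
    moreover have "(\<Sum>t\<in>T. a s t * c' t) = 0"
      unfolding split using u by (simp add: c'_def)
    moreover have "\<exists>t\<in>T. c' t \<noteq> 0" using c T by (auto simp: c'_def)
    ultimately show ?thesis using c by (intro exI[of _ c']) auto
  qed
qed

text \<open>The right-hand side is adjoined as an extra column with index \<open>None\<close>. A
  nonzero solution of the enlarged homogeneous system has a nonzero \<open>None\<close> entry by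
  injectivity, and dividing by that entry solves the original system.\<close>

lemma square_system_solvable:
  fixes a :: "'a \<Rightarrow> 'a \<Rightarrow> 'f::field"
  assumes "finite S"
    and inj: "\<And>c. (\<And>s. s \<in> S \<Longrightarrow> (\<Sum>t\<in>S. a s t * c t) = 0) \<Longrightarrow> \<forall>t\<in>S. c t = 0"
  shows "\<exists>c. \<forall>s\<in>S. (\<Sum>t\<in>S. a s t * c t) = b s"
proof -
  define T where "T = insert None (Some ` S)"
  have split: "(\<Sum>t\<in>T. f t) = f None + (\<Sum>t\<in>S. f (Some t))" for f :: "'a option \<Rightarrow> 'f"
    unfolding T_def using assms(1) by (subst sum.insert) (auto simp: sum.reindex)
  have "finite T" "card S < card T"
    unfolding T_def using assms(1) by (auto simp: card_image)
  from underdetermined_system[OF assms(1) this, of "\<lambda>s. case_option (- b s) (a s)"]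
  obtain c where c: "\<exists>t\<in>T. c t \<noteq> 0"
    "\<forall>s\<in>S. (\<Sum>t\<in>T. case_option (- b s) (a s) t * c t) = 0" by blast
  have sol: "(\<Sum>t\<in>S. a s t * c (Some t)) = b s * c None" if "s \<in> S" for s
    using c(2) that by (simp add: split)
  have "c None \<noteq> 0"
  proof
    assume "c None = 0"
    then have "\<forall>t\<in>S. c (Some t) = 0" using inj[of "\<lambda>t. c (Some t)"] sol by simp
    then show False using c(1) \<open>c None = 0\<close> by (auto simp: T_def)
  qed
  then show ?thesis using sol
    by (intro exI[of _ "\<lambda>t. c (Some t) / c None"]) (simp flip: sum_divide_distrib)
qed

section \<open>Evaluation and degree\<close>

lemma lookup_scale [simp]: "lookup (scale c p) m = c * lookup p m"
  by (simp add: scale_def map.rep_eq when_def)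

lemma lookup_reflect_vars [simp]:
  "lookup (reflect_vars p) m = (-1) ^ weight m * lookup p m"
  unfolding reflect_vars_def lookup_sum lookup_single
  by (cases "m \<in> keys p") (auto simp: when_def in_keys_iff)

lemma lookup_top_part [simp]:
  "lookup (top_part p) m = (if weight m = tdeg p then lookup p m else 0)"
  unfolding top_part_def lookup_sum lookup_single
  by (cases "m \<in> keys p") (auto simp: when_def in_keys_iff)

lemma weight_compositions: "\<eta> \<in> compositions n \<Longrightarrow> weight \<eta> = (\<Sum>i=1..n. lookup \<eta> i)"
  unfolding weight_def compositions_def
  by (intro sum.mono_neutral_left) (auto simp: in_keys_iff)

text \<open>Polymorphic, because the same monomials are evaluated over Q(r), over Q[r] once
  denominators are cleared, and at grid points.\<close>

definition mon_eval :: "(nat \<Rightarrow> 'a::comm_semiring_1) \<Rightarrow> expvec \<Rightarrow> 'a" where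
  "mon_eval v m = (\<Prod>i\<in>keys m. v i ^ lookup m i)"

lemma mon_eval_compositions:
  "m \<in> compositions n \<Longrightarrow> mon_eval v m = (\<Prod>i=1..n. v i ^ lookup m i)"
  unfolding mon_eval_def compositions_def
  by (intro prod.mono_neutral_left) (auto simp: in_keys_iff)

text \<open>A common finite index set lets polynomials with different supports be compared term by
  term.\<close>

lemma evalp_superset:
  "finite A \<Longrightarrow> keys p \<subseteq> A \<Longrightarrow> evalp p v = (\<Sum>m\<in>A. lookup p m * mon_eval v m)"
  unfolding evalp_def mon_eval_def
  by (intro sum.mono_neutral_left) (auto simp: in_keys_iff)

lemma evalp_add: "evalp (p + q) v = evalp p v + evalp q v"
proof -
  have "finite (keys p \<union> keys q)" by simp
  note e = evalp_superset[OF this]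
  show ?thesis
    using keys_add[of p q] by (subst (1 2 3) e) (auto simp: lookup_add algebra_simps sum.distrib)
qed

lemma keys_scale: "keys (scale c p) \<subseteq> keys p"
  by (auto simp: in_keys_iff)

lemma keys_reflect_vars [simp]: "keys (reflect_vars p) = keys p"
  by (auto simp: in_keys_iff)

lemma evalp_scale: "evalp (scale c p) v = c * evalp p v"
  using keys_scale[of c p]
  by (subst (1 2) evalp_superset[of "keys p"]) (auto simp: sum_distrib_left algebra_simps)

lemma evalp_diff: "evalp (p - q) v = evalp p v - evalp q v"
proof -
  have "finite (keys p \<union> keys q)" by simp
  note e = evalp_superset[OF this]
  show ?thesis
    using keys_diff[of p q]
    by (subst (1 2 3) e) (auto simp: lookup_minus algebra_simps sum_subtractf)
qed

lemma evalp_0 [simp]: "evalp 0 v = 0"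
  by (simp add: evalp_def)

lemma evalp_sum: "evalp (\<Sum>i\<in>I. f i) v = (\<Sum>i\<in>I. evalp (f i) v)"
  by (induction I rule: infinite_finite_induct) (auto simp: evalp_add)

lemma evalp_reflect_vars: "evalp (reflect_vars p) v = evalp p (\<lambda>i. - v i)"
proof -
  have "mon_eval (\<lambda>i. - v i) m = (-1) ^ weight m * mon_eval v m" for m
    by (simp add: mon_eval_def power_minus[of "v _"] prod.distrib weight_def power_sum)
  then show ?thesis
    unfolding evalp_superset[OF finite_keys order.refl] by (simp add: mult_ac)
qed

section \<open>Compositions of bounded weight and degree bounds\<close>

lemma composition_lookup_outside: "\<gamma> \<in> compositions n \<Longrightarrow> i \<notin> {1..n} \<Longrightarrow> lookup \<gamma> i = 0"
  unfolding compositions_def by (auto simp: in_keys_iff)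

lemma composition_eqI:
  assumes "\<gamma> \<in> compositions n" "\<kappa> \<in> compositions n"
    and "\<And>i. i \<in> {1..n} \<Longrightarrow> lookup \<gamma> i = lookup \<kappa> i"
  shows "\<gamma> = \<kappa>"
  using assms composition_lookup_outside by (metis poly_mapping_eqI)

text \<open>The bound is strict so that \<open>d = 0\<close> gives the empty set, matching the
  convention that only the zero polynomial has degree less than 0. A bound \<open>\<le> k\<close> is
  written as \<open>below n (Suc k)\<close>.\<close>

definition below :: "nat \<Rightarrow> nat \<Rightarrow> expvec set" where
  "below n d = {\<gamma>\<in>compositions n. weight \<gamma> < d}"

text \<open>No entry exceeds the weight, so a composition in this set amounts to a function from
  \<open>{1..n}\<close> to \<open>{..<d}\<close>.\<close>

lemma finite_below [simp, intro]: "finite (below n d)"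
proof -
  let ?r = "\<lambda>\<gamma>::expvec. restrict (lookup \<gamma>) {1..n}"
  have "inj_on ?r (compositions n)"
  proof (rule inj_onI, rule composition_eqI)
    fix x y :: expvec and k
    assume "?r x = ?r y" "k \<in> {1..n}"
    then show "lookup x k = lookup y k" by (metis restrict_apply')
  qed
  moreover have "?r ` below n d \<subseteq> PiE {1..n} (\<lambda>_. {..<d})"
  proof -
    have "lookup x i < d" if "x \<in> below n d" "i \<in> {1..n}" for x i
      using that member_le_sum[of i "{1..n}" "lookup x"]
      by (auto simp: below_def weight_compositions)
    then show ?thesis by auto
  qed
  then have "finite (?r ` below n d)" by (rule finite_subset) (auto intro: finite_PiE)
  ultimately show ?thesis
    by (auto simp: below_def intro: inj_on_subset finite_imageD)
qed

lemma mem_mpols_iff: "p \<in> mpols n \<longleftrightarrow> (\<forall>m. lookup p m \<noteq> 0 \<longrightarrow> m \<in> compositions n)"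
  by (auto simp: mpols_def in_keys_iff)

lemma keys_below_iff:
  "keys p \<subseteq> below n d \<longleftrightarrow> (\<forall>m. lookup p m \<noteq> 0 \<longrightarrow> m \<in> compositions n \<and> weight m < d)"
  by (auto simp: below_def in_keys_iff)

text \<open>The bound \<open>0 < d\<close> accounts for the value 0 that \<open>tdeg\<close> gives
  to the zero polynomial: for \<open>d = 0\<close> and \<open>p = 0\<close> only the right side
  holds.\<close>

lemma tdeg_less_iff: "0 < d \<Longrightarrow> tdeg p < d \<longleftrightarrow> (\<forall>m\<in>keys p. weight m < d)"
  by (auto simp: tdeg_def)

lemma deg_less_iff: "deg_less p d \<longleftrightarrow> (\<forall>m\<in>keys p. weight m < d)"
proof (cases "p = 0")
  case False
  then have "keys p \<noteq> {}" by simp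
  then show ?thesis using False unfolding deg_less_def
    by (cases "d = 0") (auto simp: tdeg_less_iff)
qed (auto simp: deg_less_def)

lemma keys_below_iff_deg_less: "p \<in> mpols n \<Longrightarrow> keys p \<subseteq> below n d \<longleftrightarrow> deg_less p d"
  by (auto simp: deg_less_iff mpols_def below_def)

section \<open>Uniqueness on the classical grid\<close>

text \<open>The k-th forward difference at 0 kills all powers below k and sends \<open>x^k\<close>
  to k!. It is built by differencing the previous functional.\<close>

lemma finite_difference_functional:
  "\<exists>w::nat \<Rightarrow> 'f::field_char_0. (\<forall>j<k. (\<Sum>g\<le>k. w g * of_nat g ^ j) = 0) \<and>
     (\<Sum>g\<le>k. w g * of_nat g ^ k) \<noteq> 0"
proof (induction k)
  case 0
  show ?case by (intro exI[of _ "\<lambda>_. 1"]) auto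
next
  case (Suc k)
  then obtain w :: "nat \<Rightarrow> 'f" where w: "\<forall>j<k. (\<Sum>g\<le>k. w g * of_nat g ^ j) = 0"
    "(\<Sum>g\<le>k. w g * of_nat g ^ k) \<noteq> 0" by blast
  \<comment> \<open>The functional \<open>w\<close> moved by one node, minus \<open>w\<close>:
    applied to a function h it is \<open>w\<close> applied to \<open>h (x + 1) - h x\<close>. The
    guards extend both weights by zero to the nodes up to \<open>Suc k\<close>.\<close>
  define w' where "w' g = (if g = 0 then 0 else w (g - 1)) - (if g \<le> k then w g else 0)" for g
  have shift: "(\<Sum>g\<le>Suc k. w' g * of_nat g ^ j) =
      (\<Sum>i<j. of_nat (j choose i) * (\<Sum>g\<le>k. w g * of_nat g ^ i))" for j
  proof -
    have "(\<Sum>g\<le>Suc k. w' g * of_nat g ^ j) =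
        (\<Sum>g\<le>Suc k. (if g = 0 then 0 else w (g - 1)) * of_nat g ^ j) -
        (\<Sum>g\<le>Suc k. (if g \<le> k then w g else 0) * of_nat g ^ j)"
      by (simp add: w'_def algebra_simps sum_subtractf del: sum.atMost_Suc)
    also have "(\<Sum>g\<le>Suc k. (if g \<le> k then w g else 0) * of_nat g ^ j) =
        (\<Sum>g\<le>k. w g * of_nat g ^ j)" by simp
    also have "(\<Sum>g\<le>Suc k. (if g = 0 then 0 else w (g - 1)) * of_nat g ^ j) =
        (\<Sum>g\<le>k. w g * (of_nat g + 1) ^ j)"
      by (subst sum.atMost_Suc_shift) (simp add: add.commute)
    also have "\<dots> = (\<Sum>g\<le>k. \<Sum>i\<le>j. of_nat (j choose i) * (w g * of_nat g ^ i))"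
      by (simp add: binomial_ring sum_distrib_left mult_ac)
    also have "\<dots> = (\<Sum>i\<le>j. of_nat (j choose i) * (\<Sum>g\<le>k. w g * of_nat g ^ i))"
      by (subst sum.swap) (simp add: sum_distrib_left)
    also have "\<dots> = (\<Sum>i<j. of_nat (j choose i) * (\<Sum>g\<le>k. w g * of_nat g ^ i)) +
        (\<Sum>g\<le>k. w g * of_nat g ^ j)"
      by (simp flip: lessThan_Suc_atMost)
    finally show ?thesis by simp
  qed
  \<comment> \<open>By the induction hypothesis only the term \<open>i = k\<close> of the binomial
    sum survives; its factor \<open>Suc k\<close> is nonzero in characteristic 0.\<close>
  have "(\<Sum>g\<le>Suc k. w' g * of_nat g ^ Suc k) =
      of_nat (Suc k) * (\<Sum>g\<le>k. w g * of_nat g ^ k)"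
    unfolding shift using w(1) by simp
  moreover have "\<forall>j<Suc k. (\<Sum>g\<le>Suc k. w' g * of_nat g ^ j) = 0"
    unfolding shift using w(1) by (auto intro!: sum.neutral)
  ultimately show ?case using w(2) by (intro exI[of _ w']) (simp del: sum.atMost_Suc of_nat_Suc)
qed

lemma lookup_Abs_interval [simp]:
  "lookup (Abs_poly_mapping (\<lambda>i. if i \<in> {1..n::nat} then g i else (0::nat))) i =
     (if i \<in> {1..n} then g i else 0)"
proof -
  have "finite {i. (if i \<in> {1..n} then g i else 0) \<noteq> 0}"
    by (rule finite_subset[of _ "{1..n}"]) auto
  then show ?thesis by simp
qed

text \<open>
  Applying the multivariate finite difference of order \<open>\<kappa>\<close> at the origin isolates the coefficient
  of \<open>x\<^sup>\<kappa>\<close> up to higher ones. It samples only points \<open>\<gamma> \<le> \<kappa>\<close>, so dropping some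
  points of maximal weight does no harm elsewhere.
\<close>

lemma grid_uniqueness:
  fixes c :: "expvec \<Rightarrow> 'f::field_char_0"
  assumes Z: "\<And>\<gamma>. \<gamma> \<in> Z \<Longrightarrow> Suc (weight \<gamma>) = d"
    and zero: "\<And>\<gamma>. \<gamma> \<in> below n d - Z \<Longrightarrow>
      (\<Sum>m\<in>below n d. c m * mon_eval (\<lambda>i. of_nat (lookup \<gamma> i)) m) = 0"
    and cZ: "\<And>\<kappa>. \<kappa> \<in> Z \<Longrightarrow> c \<kappa> = 0"
    and "\<kappa> \<in> below n d"
  shows "c \<kappa> = 0"
  using \<open>\<kappa> \<in> below n d\<close>
\<comment> \<open>Induction from the largest weight downwards, so coefficients of heavier exponents
  are already known to vanish.\<close>
proof (induction "d - weight \<kappa>" arbitrary: \<kappa> rule: less_induct)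
  case less
  show ?case
  proof (cases "\<kappa> \<in> Z")
    case False
    have \<kappa>: "\<kappa> \<in> compositions n" "weight \<kappa> < d" using less.prems by (auto simp: below_def)
    obtain w :: "nat \<Rightarrow> nat \<Rightarrow> 'f" where
      w: "\<And>k j. j < k \<Longrightarrow> (\<Sum>g\<le>k. w k g * of_nat g ^ j) = 0"
         "\<And>k. (\<Sum>g\<le>k. w k g * of_nat g ^ k) \<noteq> 0"
      using finite_difference_functional[where 'f = 'f] by metis
    define G where "G = PiE {1..n} (\<lambda>i. {..lookup \<kappa> i})"
    \<comment> \<open>\<open>L m\<close> is the value on \<open>x^m\<close> of the product of the
      one-variable differences of orders \<open>lookup \<kappa> i\<close>.\<close>
    define L where "L m = (\<Prod>i=1..n. \<Sum>g\<le>lookup \<kappa> i. w (lookup \<kappa> i) g * of_nat g ^ lookup m i)" for m :: expvec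
    have vanish: "(\<Sum>m\<in>below n d. c m * (\<Prod>i=1..n. of_nat (g i) ^ lookup m i)) = 0" if "g \<in> G" for g
    proof -
      define \<gamma> :: expvec where "\<gamma> = Abs_poly_mapping (\<lambda>i. if i \<in> {1..n} then g i else 0)"
      have \<gamma>: "lookup \<gamma> i = (if i \<in> {1..n} then g i else 0)" for i
        unfolding \<gamma>_def by (rule lookup_Abs_interval)
      have comp: "\<gamma> \<in> compositions n" by (auto simp: compositions_def in_keys_iff \<gamma> split: if_splits)
      have le: "lookup \<gamma> i \<le> lookup \<kappa> i" if "i \<in> {1..n}" for i
        using \<open>g \<in> G\<close> that by (auto simp: \<gamma> G_def PiE_iff)
      have wle: "weight \<gamma> \<le> weight \<kappa>"
        unfolding weight_compositions[OF comp] weight_compositions[OF \<kappa>(1)] by (rule sum_mono) (rule le)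
      \<comment> \<open>Elements of \<open>Z\<close> have the maximal weight \<open>d - 1\<close>,
        so a sample point in \<open>Z\<close> has the weight of \<kappa> and, lying below it
        entrywise, equals \<kappa>, which is not in \<open>Z\<close> in this case.\<close>
      have "\<gamma> \<notin> Z"
      proof
        assume "\<gamma> \<in> Z"
        then have "weight \<gamma> = weight \<kappa>" using Z wle \<kappa>(2) by fastforce
        then have "sum (lookup \<gamma>) {1..n} = sum (lookup \<kappa>) {1..n}"
          by (simp add: weight_compositions[OF comp] weight_compositions[OF \<kappa>(1)])
        from sum_mono_inv[OF this le]
        have eq: "lookup \<gamma> i = lookup \<kappa> i" if "i \<in> {1..n}" for i
          using that by simp
        have "\<gamma> = \<kappa>" by (rule composition_eqI[OF comp \<kappa>(1) eq])
        then show False using \<open>\<gamma> \<in> Z\<close> False by simp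
      qed
      then have "(\<Sum>m\<in>below n d. c m * mon_eval (\<lambda>i. of_nat (lookup \<gamma> i)) m) = 0"
        using zero comp wle \<kappa>(2) by (auto simp: below_def)
      moreover have "mon_eval (\<lambda>i. of_nat (lookup \<gamma> i)) m =
          ((\<Prod>i=1..n. of_nat (g i) ^ lookup m i) :: 'f)" if "m \<in> below n d" for m
        using that by (auto simp: below_def mon_eval_compositions \<gamma>)
      ultimately show ?thesis by simp
    qed
    have L: "L m = (\<Sum>g\<in>G. (\<Prod>i=1..n. w (lookup \<kappa> i) (g i)) * (\<Prod>i=1..n. of_nat (g i) ^ lookup m i))" for m
      unfolding L_def G_def by (subst prod_sum_PiE) (auto simp: prod.distrib)
    have "(\<Sum>m\<in>below n d. c m * L m) = (\<Sum>g\<in>G. (\<Prod>i=1..n. w (lookup \<kappa> i) (g i)) *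
        (\<Sum>m\<in>below n d. c m * (\<Prod>i=1..n. of_nat (g i) ^ lookup m i)))"
      unfolding L sum_distrib_left by (subst sum.swap) (simp add: mult_ac)
    also have "\<dots> = 0" using vanish by simp
    finally have sum0: "(\<Sum>m\<in>below n d. c m * L m) = 0" .
    \<comment> \<open>If some exponent of \<open>m\<close> is below that of \<kappa>, a factor of
      \<open>L m\<close> vanishes. Otherwise \<open>m\<close> dominates \<kappa> entrywise and
      differs from it, so it is heavier and the induction hypothesis gives
      \<open>c m = 0\<close>.\<close>
    have other: "c m * L m = 0" if m: "m \<in> below n d" "m \<noteq> \<kappa>" for m
    proof (cases "\<exists>i\<in>{1..n}. lookup m i < lookup \<kappa> i")
      case True
      then have "L m = 0" unfolding L_def using w(1) by fastforce
      then show ?thesis by simp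
    next
      case False
      then have le: "lookup \<kappa> i \<le> lookup m i" if "i \<in> {1..n}" for i
        using that by (simp add: not_less)
      have mc: "m \<in> compositions n" using m by (simp add: below_def)
      obtain i where i: "i \<in> {1..n}" "lookup m i \<noteq> lookup \<kappa> i"
        using composition_eqI[OF mc \<kappa>(1)] m(2) by blast
      then have "\<exists>i\<in>{1..n}. lookup \<kappa> i < lookup m i"
        using le[of i] by (intro bexI[of _ i]) simp_all
      then have "weight \<kappa> < weight m"
        unfolding weight_compositions[OF mc] weight_compositions[OF \<kappa>(1)]
        using le by (intro sum_strict_mono_ex1) blast+
      then have "c m = 0" using less.hyps[of m] m \<kappa>(2) by auto
      then show ?thesis by simp
    qed
    have "(\<Sum>m\<in>below n d - {\<kappa>}. c m * L m) = 0"
      by (intro sum.neutral ballI other) auto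
    then have "c \<kappa> * L \<kappa> = (\<Sum>m\<in>below n d. c m * L m)"
      using less.prems by (subst sum.remove[of _ \<kappa>]) auto
    moreover have "L \<kappa> \<noteq> 0" unfolding L_def using w(2) by simp
    ultimately show ?thesis using sum0 by simp
  qed (rule cZ)
qed

section \<open>Genericity in \<open>r\<close>\<close>

lemma to_fract_sum: "to_fract (sum f A) = (\<Sum>x\<in>A. to_fract (f x))"
  by (induction A rule: infinite_finite_induct) auto

lemma to_fract_prod: "to_fract (prod f A) = (\<Prod>x\<in>A. to_fract (f x))"
  by (induction A rule: infinite_finite_induct) auto

lemma to_fract_power: "to_fract (a ^ k) = to_fract a ^ k"
  by (induction k) auto

lemma to_fract_of_nat: "to_fract (of_nat k) = of_nat k"
  by (induction k) auto

lemma common_denominator: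
  fixes f :: "'a \<Rightarrow> 'b::idom fract"
  assumes "finite A"
  shows "\<exists>q c. q \<noteq> 0 \<and> (\<forall>x\<in>A. to_fract (c x) = to_fract q * f x)"
  using assms
proof (induction A rule: finite_induct)
  case empty
  show ?case by (intro exI[of _ 1]) auto
next
  case (insert x A)
  then obtain q c where qc: "q \<noteq> 0" "\<forall>x\<in>A. to_fract (c x) = to_fract q * f x" by blast
  obtain a b where ab: "f x = to_fract a / to_fract b" "b \<noteq> 0"
    by (metis Fract_cases Fract_conv_to_fract)
  have "to_fract ((\<lambda>y. if y = x then q * a else b * c y) y) = to_fract (b * q) * f y"
    if "y \<in> insert x A" for y
    using that qc ab insert.hyps(2) by auto
  then show ?case using qc(1) ab(2)
    by (intro exI[of _ "b * q"] exI[of _ "\<lambda>y. if y = x then q * a else b * c y"]) auto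
qed

text \<open>
  After clearing denominators, the coefficients of each power of \<open>r\<close> vanish one after the
  other, because at \<open>r = 0\<close> the points specialise to the grid.
\<close>

lemma generic_uniqueness:
  fixes q :: "expvec \<Rightarrow> nat \<Rightarrow> rat poly"
  assumes q0: "\<And>\<gamma> i. i \<in> {1..n} \<Longrightarrow> poly (q \<gamma> i) 0 = of_nat (lookup \<gamma> i)"
    and v: "\<And>\<gamma> i. v \<gamma> i = to_fract (q \<gamma> i)"
    and Z: "\<And>\<gamma>. \<gamma> \<in> Z \<Longrightarrow> Suc (weight \<gamma>) = d"
    and p: "keys p \<subseteq> below n d"
    and zero: "\<And>\<gamma>. \<gamma> \<in> below n d - Z \<Longrightarrow> evalp p (v \<gamma>) = 0"
    and pZ: "\<And>\<kappa>. \<kappa> \<in> Z \<Longrightarrow> lookup p \<kappa> = 0"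
  shows "p = 0"
proof -
  obtain e c where e: "e \<noteq> 0"
    and c: "\<And>m. m \<in> below n d \<Longrightarrow> to_fract (c m) = to_fract e * lookup p m"
    using common_denominator[OF finite_below, of n d "lookup p"] by blast
  have eqn: "(\<Sum>m\<in>below n d. c m * mon_eval (q \<gamma>) m) = 0" if "\<gamma> \<in> below n d - Z" for \<gamma>
  proof -
    have "to_fract (\<Sum>m\<in>below n d. c m * mon_eval (q \<gamma>) m) = to_fract e * evalp p (v \<gamma>)"
      unfolding evalp_superset[OF finite_below p] to_fract_sum sum_distrib_left
      by (intro sum.cong refl)
        (simp add: c mon_eval_def v to_fract_prod to_fract_power mult.assoc)
    then show ?thesis using zero[OF that] by (metis mult_zero_right to_fract_eq_0_iff)
  qed
  have coeff0: "coeff (c m) k = 0" if "m \<in> below n d" for m k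
    using that
  proof (induction k arbitrary: m rule: less_induct)
    case (less k)
    have "(\<Sum>m\<in>below n d. coeff (c m) k * mon_eval (\<lambda>i. of_nat (lookup \<gamma> i)) m) = 0"
      if \<gamma>: "\<gamma> \<in> below n d - Z" for \<gamma>
    proof -
      have "coeff (c m * mon_eval (q \<gamma>) m) k =
          coeff (c m) k * mon_eval (\<lambda>i. of_nat (lookup \<gamma> i)) m" if m: "m \<in> below n d" for m
      proof -
        \<comment> \<open>The lower coefficients of \<open>c m\<close> are already zero, so only one
          term of the convolution remains; it involves the monomial at \<open>r = 0\<close>, that
          is, at the grid point.\<close>
        have "coeff (c m * mon_eval (q \<gamma>) m) k = coeff (c m) k * coeff (mon_eval (q \<gamma>) m) 0"
          using less.IH m unfolding coeff_mult
          by (subst sum.remove[of _ k]) (auto intro!: sum.neutral)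
        also have "coeff (mon_eval (q \<gamma>) m) 0 = mon_eval (\<lambda>i. of_nat (lookup \<gamma> i)) m"
          using m q0 by (simp add: below_def mon_eval_compositions[of m n] poly_prod flip: poly_0_coeff_0)
        finally show ?thesis .
      qed
      then have "(\<Sum>m\<in>below n d. coeff (c m) k * mon_eval (\<lambda>i. of_nat (lookup \<gamma> i)) m) =
          coeff (\<Sum>m\<in>below n d. c m * mon_eval (q \<gamma>) m) k"
        by (simp add: coeff_sum)
      then show ?thesis using eqn[OF \<gamma>] by simp
    qed
    moreover have "coeff (c \<kappa>) k = 0" if "\<kappa> \<in> Z \<inter> below n d" for \<kappa>
      using c[of \<kappa>] pZ[of \<kappa>] that by simp
    ultimately show ?case 
      using grid_uniqueness[of "Z \<inter> below n d" d n "\<lambda>m. coeff (c m) k" m] Z less.prems by blast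
  qed
  show ?thesis
  proof (rule poly_mapping_eqI)
    fix m
    show "lookup p m = lookup 0 m"
    proof (cases "m \<in> below n d")
      case True
      then have "c m = 0" using coeff0 by (simp add: poly_eq_iff)
      then show ?thesis using c[OF True] e by simp
    next
      case False
      then show ?thesis using p by (auto simp: in_keys_iff)
    qed
  qed
qed

section \<open>Sorting compositions\<close>

text \<open>Indices are ranked by decreasing value, with ties broken by position. This is a total
  order, so \<open>rank\<close> is a permutation, and its inverse sorts.\<close>

lemma sorting_permutation_exists:
  fixes f :: "nat \<Rightarrow> nat"
  shows "\<exists>w. w permutes {1..n} \<and> (\<forall>i\<in>{1..n}. \<forall>j\<in>{1..n}. i \<le> j \<longrightarrow> f (w j) \<le> f (w i))"
proof -
  define prec where "prec k i \<longleftrightarrow> f i < f k \<or> (f i = f k \<and> k \<le> i)" for k i :: nat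
  define rank where "rank i = (if i \<in> {1..n} then card {k \<in> {1..n}. prec k i} else i)" for i
  have less: "rank i < rank j" if "i \<in> {1..n}" "j \<in> {1..n}" "prec i j" "i \<noteq> j" for i j
  proof -
    have "{k \<in> {1..n}. prec k i} \<subset> {k \<in> {1..n}. prec k j}"
      using that by (auto simp: prec_def)
    then show ?thesis using that by (auto simp: rank_def intro!: psubset_card_mono)
  qed
  have total: "prec i j \<or> prec j i" for i j by (auto simp: prec_def)
  have "inj_on rank {1..n}"
    by (rule inj_onI) (metis less total less_irrefl)
  moreover have "rank ` {1..n} \<subseteq> {1..n}"
  proof (rule image_subsetI)
    fix i assume i: "i \<in> {1..n}"
    then have "i \<in> {k \<in> {1..n}. prec k i}" by (simp add: prec_def)
    then have "card {k \<in> {1..n}. prec k i} > 0" by (subst card_gt_0_iff) auto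
    moreover have "card {k \<in> {1..n}. prec k i} \<le> card {1..n}" by (rule card_mono) auto
    ultimately show "rank i \<in> {1..n}" using i by (simp add: rank_def)
  qed
  ultimately have "bij_betw rank {1..n} {1..n}"
    by (simp add: bij_betw_def endo_inj_surj)
  then have perm: "rank permutes {1..n}"
    by (rule bij_imp_permutes) (auto simp: rank_def)
  have "f (inv rank j) \<le> f (inv rank i)" if "i \<in> {1..n}" "j \<in> {1..n}" "i \<le> j" for i j
  proof (rule ccontr)
    let ?a = "inv rank i" and ?b = "inv rank j"
    assume "\<not> f ?b \<le> f ?a"
    then have "prec ?b ?a" "?b \<noteq> ?a" by (auto simp: prec_def)
    moreover have "?a \<in> {1..n}" "?b \<in> {1..n}"
      using that permutes_in_image[OF permutes_inv[OF perm]] by blast+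
    ultimately have "rank ?b < rank ?a" using less by blast
    then show False using that by (simp add: permutes_inverses[OF perm])
  qed
  then show ?thesis using permutes_inv[OF perm] by blast
qed

section \<open>Permutations acting on exponent vectors\<close>

lemma lookup_map_key_permutes:
  "w permutes A \<Longrightarrow> lookup (Poly_Mapping.map_key w m) i = lookup m (w i)"
  by (simp add: map_key.rep_eq permutes_inj)

lemma map_key_permutes_compositions:
  "w permutes {1..n} \<Longrightarrow> Poly_Mapping.map_key w m \<in> compositions n \<longleftrightarrow> m \<in> compositions n"
  by (simp add: compositions_def keys_map_key permutes_inj vimage_subset_eq permutes_bij permutes_image)

lemma weight_map_key:
  assumes "w permutes {1..n}"
  shows "weight (Poly_Mapping.map_key w m) = weight m"
proof -
  have "w ` keys (Poly_Mapping.map_key w m) = keys m"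
    using permutes_surj[OF assms] by (simp add: keys_map_key permutes_inj[OF assms])
  moreover have "inj_on w A" for A using permutes_inj[OF assms] by (rule inj_on_subset) simp
  ultimately show ?thesis
    unfolding weight_def
    by (metis (no_types, lifting) lookup_map_key_permutes[OF assms] sum.cong sum.reindex comp_apply)
qed

text \<open>The level sets \<open>{i. j \<le> \<mu> i}\<close> of a partition are initial segments
  of \<open>{1..n}\<close>. Rearranging preserves their cardinalities, hence the segments
  themselves, and these determine the entries.\<close>

lemma partition_rearrangement_unique:
  assumes \<mu>: "\<mu> \<in> partitions n" "Poly_Mapping.map_key w \<mu> \<in> partitions n" "w permutes {1..n}"
  shows "Poly_Mapping.map_key w \<mu> = \<mu>"
proof (rule composition_eqI)
  let ?\<nu> = "Poly_Mapping.map_key w \<mu>"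
  fix i assume i: "i \<in> {1..n}"
  define A where "A j = {i\<in>{1..n}. j \<le> lookup \<mu> i}" for j
  define B where "B j = {i\<in>{1..n}. j \<le> lookup ?\<nu> i}" for j
  have eq: "A j = B j" for j
  proof -
    have "w ` B j = A j"
    proof (intro equalityI subsetI)
      fix x assume "x \<in> w ` B j"
      then obtain y where "x = w y" "y \<in> {1..n}" "j \<le> lookup \<mu> (w y)"
        by (auto simp: B_def lookup_map_key_permutes[OF \<mu>(3)])
      then show "x \<in> A j" using permutes_in_image[OF \<mu>(3)] unfolding A_def by blast
    next
      fix x assume "x \<in> A j"
      then have "inv w x \<in> B j" using permutes_in_image[OF permutes_inv[OF \<mu>(3)], of x]
        by (simp add: A_def B_def lookup_map_key_permutes[OF \<mu>(3)] permutes_inverses[OF \<mu>(3)])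
      then show "x \<in> w ` B j"
        by (metis imageI permutes_inverses(1)[OF \<mu>(3)])
    qed
    then have card: "card (A j) = card (B j)"
      by (metis card_image inj_on_subset permutes_inj[OF \<mu>(3)] subset_UNIV)
    have fin: "finite (A j)" "finite (B j)" by (auto simp: A_def B_def)
    have down: "k \<in> A j" if "l \<in> A j" "k \<in> {1..n}" "k \<le> l" for k l
      using that \<mu>(1) by (auto simp: A_def partitions_def intro: order.trans)
    have down': "k \<in> B j" if "l \<in> B j" "k \<in> {1..n}" "k \<le> l" for k l
      using that \<mu>(2) by (auto simp: B_def partitions_def intro: order.trans)
    have "A j \<subseteq> {1..n}" "B j \<subseteq> {1..n}" by (auto simp: A_def B_def)
    then have "A j \<subseteq> B j \<or> B j \<subseteq> A j" using down down' by (meson subset_iff nat_le_linear)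
    then show ?thesis using card fin by (metis card_subset_eq)
  qed
  have "j \<le> lookup ?\<nu> i \<longleftrightarrow> j \<le> lookup \<mu> i" for j
    using eq[of j] i by (auto simp: A_def B_def)
  then show "lookup ?\<nu> i = lookup \<mu> i" by (meson dual_order.antisym order.refl)
qed (use \<mu> in \<open>auto simp: partitions_def\<close>)

text \<open>An \<open>arg_min\<close> over the naturals lies in its candidate set as soon as that
  set is nonempty, which a sorting permutation shows.\<close>

lemma sort_perm:
  assumes "\<gamma> \<in> compositions n"
  shows "sort_perm n \<gamma> permutes {1..n}"
    and "Poly_Mapping.map_key (sort_perm n \<gamma>) \<gamma> \<in> partitions n"
proof -
  let ?Q = "\<lambda>w. w permutes {1..n} \<and>
    (\<exists>\<mu>\<in>partitions n. lookup \<mu> = perm_act (inv w) (lookup \<gamma>))"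
  obtain w where w: "w permutes {1..n}"
    "\<forall>i\<in>{1..n}. \<forall>j\<in>{1..n}. i \<le> j \<longrightarrow> lookup \<gamma> (w j) \<le> lookup \<gamma> (w i)"
    using sorting_permutation_exists by blast
  have act: "lookup (Poly_Mapping.map_key w \<gamma>) = perm_act (inv w) (lookup \<gamma>)"
    if "w permutes {1..n}" for w
    using that by (auto simp: perm_act_def permutes_inv_inv lookup_map_key_permutes)
  have "Poly_Mapping.map_key w \<gamma> \<in> partitions n"
    using w assms map_key_permutes_compositions[OF w(1)]
    by (simp add: partitions_def lookup_map_key_permutes[OF w(1)])
  with w(1) act[OF w(1)] have "?Q w" by blast
  then have Q: "?Q (sort_perm n \<gamma>)" unfolding sort_perm_def by (rule arg_min_natI[where P = ?Q])
  then show perm: "sort_perm n \<gamma> permutes {1..n}" by blast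
  from Q obtain \<mu> where "\<mu> \<in> partitions n" "lookup \<mu> = lookup (Poly_Mapping.map_key (sort_perm n \<gamma>) \<gamma>)"
    using act[OF perm] by auto
  then show "Poly_Mapping.map_key (sort_perm n \<gamma>) \<gamma> \<in> partitions n"
    by (metis poly_mapping_eqI)
qed

lemma bar_sort_perm:
  assumes "\<gamma> \<in> compositions n"
  shows "bar n \<gamma> (sort_perm n \<gamma> i) =
    of_nat (lookup (Poly_Mapping.map_key (sort_perm n \<gamma>) \<gamma>) i) + r_delta n i"
  by (simp add: bar_def perm_act_def lookup_map_key_permutes[OF sort_perm(1)[OF assms]]
      permutes_inverses[OF sort_perm(1)[OF assms]])

section \<open>Interpolation\<close>

text \<open>At the exponents in \<open>Z\<close>, all of top weight, the value condition is traded
  for a coefficient condition. \<open>Z = {}\<close> is plain interpolation;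
  \<open>Z = {\<eta>}\<close> allows the coefficient on \<open>x^\<eta>\<close> to be
  normalised.\<close>

lemma interpolation_unique:
  assumes "\<And>\<gamma>. \<gamma> \<in> Z \<Longrightarrow> Suc (weight \<gamma>) = d"
    and "keys p \<subseteq> below n d"
    and "\<And>\<gamma>. \<gamma> \<in> below n d - Z \<Longrightarrow> evalp p (bar n \<gamma>) = 0"
    and "\<And>\<kappa>. \<kappa> \<in> Z \<Longrightarrow> lookup p \<kappa> = 0"
  shows "p = 0"
proof (rule generic_uniqueness[OF _ _ assms])
  \<comment> \<open>The coordinates of \<open>bar n \<gamma>\<close> as polynomials in
    \<open>r\<close>; their constant terms are the entries of \<gamma>.\<close>
  let ?q = "\<lambda>\<gamma> i. of_nat (lookup \<gamma> i) + [:0, 1:] * of_nat (n - inv (sort_perm n \<gamma>) i) :: rat poly"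
  show "poly (?q \<gamma> i) 0 = of_nat (lookup \<gamma> i)" for \<gamma> i
    by (simp add: poly_of_nat)
  show "bar n \<gamma> i = to_fract (?q \<gamma> i)" for \<gamma> i
    by (simp only: bar_def perm_act_def r_delta_def comp_def r_def to_fract_add to_fract_mult
        to_fract_of_nat) (simp add: to_fract_def)
qed

text \<open>There is one functional for each generator \<open>B t\<close>, so the matrix is square
  and injectivity already yields solvability.\<close>

lemma functionals_solvable:
  assumes "finite S"
    and lin: "\<And>c s. s \<in> S \<Longrightarrow> \<phi> s (\<Sum>t\<in>S. scale (c t) (B t)) = (\<Sum>t\<in>S. c t * \<phi> s (B t))"
    and inj: "\<And>c. (\<And>s. s \<in> S \<Longrightarrow> \<phi> s (\<Sum>t\<in>S. scale (c t) (B t)) = 0) \<Longrightarrow> \<forall>t\<in>S. c t = 0"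
  shows "\<exists>c. \<forall>s\<in>S. \<phi> s (\<Sum>t\<in>S. scale (c t) (B t)) = b s"
proof -
  have "\<exists>c. \<forall>s\<in>S. (\<Sum>t\<in>S. \<phi> s (B t) * c t) = b s"
  proof (rule square_system_solvable[OF assms(1)])
    fix c assume "\<And>s. s \<in> S \<Longrightarrow> (\<Sum>t\<in>S. \<phi> s (B t) * c t) = 0"
    then show "\<forall>t\<in>S. c t = 0" using lin by (intro inj) (simp add: mult.commute)
  qed
  then show ?thesis using lin by (simp add: mult.commute)
qed

lemma lookup_sum_scale: "lookup (\<Sum>t\<in>S. scale (c t) (B t)) m = (\<Sum>t\<in>S. c t * lookup (B t) m)"
  by (simp add: lookup_sum)

lemma evalp_sum_scale: "evalp (\<Sum>t\<in>S. scale (c t) (B t)) v = (\<Sum>t\<in>S. c t * evalp (B t) v)"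
  by (simp add: evalp_sum evalp_scale)

lemma keys_sum_scale:
  "(\<And>t. t \<in> S \<Longrightarrow> keys (B t) \<subseteq> A) \<Longrightarrow> keys (\<Sum>t\<in>S. scale (c t) (B t)) \<subseteq> A"
  using keys_sum[of "\<lambda>t. scale (c t) (B t)" S] keys_scale by blast

text \<open>Conditions and monomials are both indexed by \<open>below n d\<close>, so existence
  follows from \<open>interpolation_unique\<close>.\<close>

lemma interpolation_exists:
  assumes Z: "\<And>\<gamma>. \<gamma> \<in> Z \<Longrightarrow> Suc (weight \<gamma>) = d" "Z \<subseteq> compositions n"
  shows "\<exists>p. keys p \<subseteq> below n d \<and> (\<forall>\<gamma>\<in>below n d - Z. evalp p (bar n \<gamma>) = b \<gamma>) \<and>
    (\<forall>\<kappa>\<in>Z. lookup p \<kappa> = b \<kappa>)"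
proof -
  let ?S = "below n d" and ?B = "\<lambda>m. Poly_Mapping.single m (1 :: ratfun)"
  define \<phi> where "\<phi> \<gamma> p = (if \<gamma> \<in> Z then lookup p \<gamma> else evalp p (bar n \<gamma>))" for \<gamma> p
  have Zb: "Z \<subseteq> ?S" using Z by (force simp: below_def)
  have keys: "keys (\<Sum>t\<in>?S. scale (c t) (?B t)) \<subseteq> ?S" for c
    by (rule keys_sum_scale) simp
  have "\<exists>c. \<forall>\<gamma>\<in>?S. \<phi> \<gamma> (\<Sum>t\<in>?S. scale (c t) (?B t)) = b \<gamma>"
  proof (rule functionals_solvable)
    fix c assume zero: "\<And>\<gamma>. \<gamma> \<in> ?S \<Longrightarrow> \<phi> \<gamma> (\<Sum>t\<in>?S. scale (c t) (?B t)) = 0"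
    have "(\<Sum>t\<in>?S. scale (c t) (?B t)) = 0"
    proof (rule interpolation_unique[OF Z(1) keys])
      show "evalp (\<Sum>t\<in>?S. scale (c t) (?B t)) (bar n \<gamma>) = 0" if "\<gamma> \<in> ?S - Z" for \<gamma>
        using zero[of \<gamma>] that by (simp add: \<phi>_def)
      show "lookup (\<Sum>t\<in>?S. scale (c t) (?B t)) \<gamma> = 0" if "\<gamma> \<in> Z" for \<gamma>
        using zero[of \<gamma>] that Zb by (auto simp: \<phi>_def)
    qed
    moreover have "lookup (\<Sum>t\<in>?S. scale (c t) (?B t)) m = c m" if "m \<in> ?S" for m
      using that by (simp add: lookup_sum_scale lookup_single when_def if_distrib cong: if_cong)
    ultimately show "\<forall>t\<in>?S. c t = 0" by simp
  qed (auto simp: \<phi>_def lookup_sum_scale evalp_sum_scale)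
  then obtain p where p: "keys p \<subseteq> ?S" "\<And>\<gamma>. \<gamma> \<in> ?S \<Longrightarrow> \<phi> \<gamma> p = b \<gamma>"
    using keys by blast
  have "evalp p (bar n \<gamma>) = b \<gamma>" if "\<gamma> \<in> ?S - Z" for \<gamma>
    using p(2)[of \<gamma>] that by (simp add: \<phi>_def)
  moreover have "lookup p \<kappa> = b \<kappa>" if "\<kappa> \<in> Z" for \<kappa>
    using p(2)[of \<kappa>] that Zb by (auto simp: \<phi>_def)
  ultimately show ?thesis using p(1) by blast
qed

section \<open>Symmetric interpolation\<close>

text \<open>Moving the exponents along with the variables keeps the value of each monomial, and
  symmetry keeps its coefficient, so the sum is merely reindexed.\<close>

lemma evalp_permute:
  assumes p: "p \<in> sym_mpols n" and w: "w permutes {1..n}"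
  shows "evalp p (\<lambda>i. v (w i)) = evalp p v"
proof -
  let ?k = "Poly_Mapping.map_key w"
  have sym: "lookup p (?k m) = lookup p m"
    "lookup p (Poly_Mapping.map_key (inv w) m) = lookup p m" for m
    using p w permutes_inv[OF w] by (simp_all add: sym_mpols_def)
  have comp: "m \<in> compositions n" if "m \<in> keys p" for m
    using p that by (auto simp: sym_mpols_def mpols_def)
  have inv: "?k (Poly_Mapping.map_key (inv w) m) = m" "Poly_Mapping.map_key (inv w) (?k m) = m" for m
    by (rule poly_mapping_eqI, simp add: lookup_map_key_permutes[OF w]
      lookup_map_key_permutes[OF permutes_inv[OF w]] permutes_inverses[OF w])+
  have "mon_eval (\<lambda>i. v (w i)) (?k m) = mon_eval v m" if "m \<in> compositions n" for m
  proof -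
    have "mon_eval v m = (\<Prod>i\<in>{1..n}. v (w i) ^ lookup m (w i))"
      unfolding mon_eval_compositions[OF that]
      using permutes_image[OF w] permutes_inj_on[OF w]
      by (metis (mono_tags, lifting) comp_apply prod.cong prod.reindex)
    then show ?thesis
      using that by (subst mon_eval_compositions[where n = n])
        (auto simp: map_key_permutes_compositions[OF w] lookup_map_key_permutes[OF w])
  qed
  then have "(\<Sum>m\<in>keys p. lookup p m * mon_eval v m) =
      (\<Sum>m\<in>keys p. lookup p m * mon_eval (\<lambda>i. v (w i)) m)"
    using sym inv comp
    by (intro sum.reindex_bij_witness[of _ "Poly_Mapping.map_key (inv w)" ?k])
      (auto simp: in_keys_iff)
  then show ?thesis by (simp add: evalp_superset[OF finite_keys order.refl])
qed

text \<open>The function \<open>f\<close> is the identity or negation in the applications, so that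
  both the interpolation points and their negatives are covered.\<close>

lemma evalp_bar_sym:
  assumes "p \<in> sym_mpols n" "\<gamma> \<in> compositions n"
  shows "evalp p (\<lambda>i. f (bar n \<gamma> i)) =
    evalp p (\<lambda>i. f (of_nat (lookup (Poly_Mapping.map_key (sort_perm n \<gamma>) \<gamma>) i) + r_delta n i))"
  unfolding bar_sort_perm[OF assms(2), symmetric]
  by (rule evalp_permute[OF assms(1) sort_perm(1)[OF assms(2)], symmetric])

text \<open>Reduction to \<open>interpolation_unique\<close>: a symmetric polynomial takes the same
  value at \<open>bar n \<gamma>\<close> as at the point of the sorted \<gamma>.\<close>

lemma sym_interpolation_unique:
  assumes Z: "\<And>\<mu>. \<mu> \<in> Z \<Longrightarrow> Suc (weight \<mu>) = d"
    and p: "p \<in> sym_mpols n" "keys p \<subseteq> below n d"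
    and zero: "\<And>\<mu>. \<mu> \<in> below n d \<inter> partitions n - Z \<Longrightarrow>
      evalp p (\<lambda>i. of_nat (lookup \<mu> i) + r_delta n i) = 0"
    and pZ: "\<And>\<kappa>. \<kappa> \<in> Z \<Longrightarrow> lookup p \<kappa> = 0"
  shows "p = 0"
proof (rule interpolation_unique)
  let ?s = "\<lambda>\<gamma>. Poly_Mapping.map_key (sort_perm n \<gamma>) \<gamma>"
  \<comment> \<open>By symmetry the coefficient conditions on \<open>Z\<close> carry over to all
    rearrangements of its elements.\<close>
  define Z' where "Z' = {\<gamma> \<in> compositions n. ?s \<gamma> \<in> Z}"
  show "Suc (weight \<gamma>) = d" if "\<gamma> \<in> Z'" for \<gamma>
    using that Z[of "?s \<gamma>"] weight_map_key[OF sort_perm(1), of \<gamma> n \<gamma>] by (simp add: Z'_def)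
  show "lookup p \<gamma> = 0" if "\<gamma> \<in> Z'" for \<gamma>
  proof -
    have "lookup p \<gamma> = lookup p (?s \<gamma>)"
      using p(1) sort_perm(1)[of \<gamma> n] that by (simp add: sym_mpols_def Z'_def)
    then show ?thesis using pZ that by (simp add: Z'_def)
  qed
  show "evalp p (bar n \<gamma>) = 0" if "\<gamma> \<in> below n d - Z'" for \<gamma>
  proof -
    have \<gamma>: "\<gamma> \<in> compositions n" "weight \<gamma> < d" "?s \<gamma> \<notin> Z"
      using that by (auto simp: below_def Z'_def)
    moreover have "?s \<gamma> \<in> below n d" using \<gamma> sort_perm(1)[OF \<gamma>(1)]
      by (simp add: below_def map_key_permutes_compositions weight_map_key)
    ultimately show ?thesis
      using zero[of "?s \<gamma>"] sort_perm(2)[OF \<gamma>(1)] evalp_bar_sym[OF p(1) \<gamma>(1), of "\<lambda>x. x"] by simp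
  qed
qed (rule p(2))

section \<open>Monomial symmetric polynomials and symmetric interpolation\<close>

definition perm_orbit :: "nat \<Rightarrow> expvec \<Rightarrow> expvec set" where
  "perm_orbit n \<kappa> = (\<lambda>w. Poly_Mapping.map_key w \<kappa>) ` {w. w permutes {1..n}}"

text \<open>The sum runs over the orbit as a set, not over permutations, so repeated entries in
  \<kappa> do not produce multiplicities.\<close>

definition monomial_sym :: "nat \<Rightarrow> expvec \<Rightarrow> mpol" where
  "monomial_sym n \<kappa> = (\<Sum>\<gamma>\<in>perm_orbit n \<kappa>. Poly_Mapping.single \<gamma> 1)"

lemma lookup_monomial_sym: "lookup (monomial_sym n \<kappa>) m = (if m \<in> perm_orbit n \<kappa> then 1 else 0)"
proof -
  have "finite (perm_orbit n \<kappa>)" by (simp add: perm_orbit_def finite_permutations)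
  then show ?thesis by (simp add: monomial_sym_def lookup_sum lookup_single when_def)
qed

lemma keys_monomial_sym: "keys (monomial_sym n \<kappa>) = perm_orbit n \<kappa>"
  by (auto simp: in_keys_iff lookup_monomial_sym split: if_splits)

lemma perm_orbit_map_key:
  assumes w: "w permutes {1..n}"
  shows "Poly_Mapping.map_key w \<gamma> \<in> perm_orbit n \<kappa> \<longleftrightarrow> \<gamma> \<in> perm_orbit n \<kappa>"
proof -
  have closed: "Poly_Mapping.map_key w \<gamma> \<in> perm_orbit n \<kappa>"
    if "\<gamma> \<in> perm_orbit n \<kappa>" "w permutes {1..n}" for w \<gamma>
    using that by (auto simp: perm_orbit_def map_key_compose permutes_inj intro!: imageI permutes_compose)
  have "Poly_Mapping.map_key (inv w) (Poly_Mapping.map_key w \<gamma>) = \<gamma>"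
    by (rule poly_mapping_eqI) (simp add: lookup_map_key_permutes[OF w]
      lookup_map_key_permutes[OF permutes_inv[OF w]] permutes_inverses[OF w])
  then show ?thesis using closed w permutes_inv[OF w] by metis
qed

lemma sym_mpols_sum_scale:
  assumes "\<And>t. t \<in> S \<Longrightarrow> B t \<in> sym_mpols n"
  shows "(\<Sum>t\<in>S. scale (c t) (B t)) \<in> sym_mpols n"
  using assms keys_sum_scale[of S B "compositions n" c]
  by (simp add: sym_mpols_def mpols_def lookup_sum_scale)

lemma monomial_sym_in_sym_mpols: "\<kappa> \<in> compositions n \<Longrightarrow> monomial_sym n \<kappa> \<in> sym_mpols n"
  by (auto simp: sym_mpols_def mpols_def keys_monomial_sym lookup_monomial_sym perm_orbit_map_key)
    (auto simp: perm_orbit_def map_key_permutes_compositions)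

text \<open>Again a square system: the basis of monomial symmetric polynomials and the conditions
  are both indexed by the partitions of weight below \<open>d\<close>.\<close>

lemma sym_interpolation_exists:
  assumes Z: "\<And>\<mu>. \<mu> \<in> Z \<Longrightarrow> Suc (weight \<mu>) = d" "Z \<subseteq> partitions n"
  shows "\<exists>p\<in>sym_mpols n. keys p \<subseteq> below n d \<and>
    (\<forall>\<mu>\<in>below n d \<inter> partitions n - Z.
      evalp p (\<lambda>i. of_nat (lookup \<mu> i) + r_delta n i) = b \<mu>) \<and>
    (\<forall>\<kappa>\<in>Z. lookup p \<kappa> = b \<kappa>)"
proof -
  let ?S = "below n d \<inter> partitions n" and ?B = "monomial_sym n"
  define \<phi> where "\<phi> \<mu> p = (if \<mu> \<in> Z then lookup p \<mu>
    else evalp p (\<lambda>i. of_nat (lookup \<mu> i) + r_delta n i))" for \<mu> p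
  have Zb: "Z \<subseteq> ?S" using Z by (force simp: below_def partitions_def)
  have keys: "keys (\<Sum>t\<in>?S. scale (c t) (?B t)) \<subseteq> below n d" for c
  proof (rule keys_sum_scale)
    fix t assume "t \<in> ?S"
    then show "keys (?B t) \<subseteq> below n d"
      by (auto simp: keys_monomial_sym perm_orbit_def below_def map_key_permutes_compositions
        weight_map_key)
  qed
  have sym: "(\<Sum>t\<in>?S. scale (c t) (?B t)) \<in> sym_mpols n" for c
    by (rule sym_mpols_sum_scale) (auto simp: partitions_def intro: monomial_sym_in_sym_mpols)
  have "\<exists>c. \<forall>\<mu>\<in>?S. \<phi> \<mu> (\<Sum>t\<in>?S. scale (c t) (?B t)) = b \<mu>"
  proof (rule functionals_solvable)
    fix c assume zero: "\<And>\<mu>. \<mu> \<in> ?S \<Longrightarrow> \<phi> \<mu> (\<Sum>t\<in>?S. scale (c t) (?B t)) = 0"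
    have "(\<Sum>t\<in>?S. scale (c t) (?B t)) = 0"
    proof (rule sym_interpolation_unique[OF Z(1) sym keys])
      show "evalp (\<Sum>t\<in>?S. scale (c t) (?B t)) (\<lambda>i. of_nat (lookup \<mu> i) + r_delta n i) = 0"
        if "\<mu> \<in> ?S - Z" for \<mu>
        using zero[of \<mu>] that by (simp add: \<phi>_def)
      show "lookup (\<Sum>t\<in>?S. scale (c t) (?B t)) \<mu> = 0" if "\<mu> \<in> Z" for \<mu>
        using zero[of \<mu>] that Zb by (auto simp: \<phi>_def)
    qed
    moreover have "lookup (\<Sum>t\<in>?S. scale (c t) (?B t)) m = c m" if m: "m \<in> ?S" for m
    proof -
      \<comment> \<open>An orbit contains only one partition, so the coefficient on
        \<open>x^m\<close> for a partition \<open>m\<close> reads off \<open>c m\<close>.\<close>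
      have "m \<in> perm_orbit n t \<longleftrightarrow> m = t" if "t \<in> ?S" for t
      proof
        assume "m \<in> perm_orbit n t"
        then show "m = t"
          using partition_rearrangement_unique m that by (auto simp: perm_orbit_def)
      next
        assume "m = t"
        then show "m \<in> perm_orbit n t"
          unfolding perm_orbit_def using map_key_id[of t] permutes_id[of "{1..n}"]
          by (intro image_eqI[of _ _ id]) (simp_all add: id_def)
      qed
      then have "lookup (\<Sum>t\<in>?S. scale (c t) (?B t)) m = (\<Sum>t\<in>?S. c t * (if m = t then 1 else 0))"
        by (simp add: lookup_sum_scale lookup_monomial_sym)
      then show ?thesis using m by (simp add: if_distrib cong: if_cong)
    qed
    ultimately show "\<forall>t\<in>?S. c t = 0" by simp
  qed (auto simp: \<phi>_def lookup_sum_scale evalp_sum_scale)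
  then obtain p where p: "keys p \<subseteq> below n d" "p \<in> sym_mpols n"
    "\<And>\<mu>. \<mu> \<in> ?S \<Longrightarrow> \<phi> \<mu> p = b \<mu>"
    using keys sym by blast
  have "evalp p (\<lambda>i. of_nat (lookup \<mu> i) + r_delta n i) = b \<mu>" if "\<mu> \<in> ?S - Z" for \<mu>
    using p(3)[of \<mu>] that by (simp add: \<phi>_def)
  moreover have "lookup p \<kappa> = b \<kappa>" if "\<kappa> \<in> Z" for \<kappa>
    using p(3)[of \<kappa>] that Zb by (auto simp: \<phi>_def)
  ultimately show ?thesis using p(1,2) by blast
qed

section \<open>The interpolation polynomials\<close>

lemma keys_below_iff_tdeg: "p \<in> mpols n \<Longrightarrow> keys p \<subseteq> below n (Suc k) \<longleftrightarrow> tdeg p \<le> k"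
  using tdeg_less_iff[of "Suc k" p] by (auto simp: mpols_def below_def less_Suc_eq_le)

lemma tdeg_eqI:
  assumes "p \<in> mpols n" "keys p \<subseteq> below n (Suc (weight \<eta>))" "lookup p \<eta> \<noteq> 0"
  shows "tdeg p = weight \<eta>"
proof (rule antisym)
  show "tdeg p \<le> weight \<eta>" using assms keys_below_iff_tdeg by blast
  show "weight \<eta> \<le> tdeg p" unfolding tdeg_def using assms(3)
    by (intro Max_ge) (auto simp: in_keys_iff)
qed

lemma below_subset_compositions: "below n d \<subseteq> compositions n"
  by (auto simp: below_def)

text \<open>Interpolation with \<open>Z = {\<eta>}\<close> prescribes the coefficient on
  \<open>x^\<eta>\<close> in place of the value at \<open>bar n \<eta>\<close>. Its unique
  solvability justifies the definite description.\<close>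

lemma E_int:
  assumes "\<eta> \<in> compositions n"
  shows "E_int n \<eta> \<in> mpols n" and "tdeg (E_int n \<eta>) = weight \<eta>"
    and "\<And>\<gamma>. \<gamma> \<in> compositions n \<Longrightarrow> \<gamma> \<noteq> \<eta> \<Longrightarrow> weight \<gamma> \<le> weight \<eta> \<Longrightarrow>
      evalp (E_int n \<eta>) (bar n \<gamma>) = 0"
    and "lookup (E_int n \<eta>) \<eta> = 1"
proof -
  let ?d = "Suc (weight \<eta>)"
  let ?Q = "\<lambda>p. p \<in> mpols n \<and> tdeg p = weight \<eta> \<and>
     (\<forall>\<gamma>\<in>compositions n. \<gamma> \<noteq> \<eta> \<and> weight \<gamma> \<le> weight \<eta> \<longrightarrow> evalp p (bar n \<gamma>) = 0) \<and>
     lookup p \<eta> = 1"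
  obtain p where p: "keys p \<subseteq> below n ?d" "\<And>\<gamma>. \<gamma> \<in> below n ?d - {\<eta>} \<Longrightarrow> evalp p (bar n \<gamma>) = 0"
    "lookup p \<eta> = 1"
    using interpolation_exists[of "{\<eta>}" ?d n "\<lambda>\<gamma>. if \<gamma> = \<eta> then 1 else 0"] assms by auto
  have mp: "p \<in> mpols n" using p(1) below_subset_compositions by (auto simp: mpols_def)
  have "evalp p (bar n \<gamma>) = 0" if "\<gamma> \<in> compositions n" "\<gamma> \<noteq> \<eta>" "weight \<gamma> \<le> weight \<eta>" for \<gamma>
    using that by (intro p(2)) (simp add: below_def)
  then have "?Q p" using p(3) mp tdeg_eqI[OF mp p(1)] by simp
  moreover have "q = p" if "?Q q" for q
  proof -
    have "keys q \<subseteq> below n ?d" using that keys_below_iff_tdeg[of q n "weight \<eta>"] by simp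
    then have keys: "keys (q - p) \<subseteq> below n ?d" using keys_diff[of q p] p(1) by blast
    have "q - p = 0"
      using that p(2,3)
      by (intro interpolation_unique[OF _ keys, of "{\<eta>}"])
        (simp_all add: evalp_diff lookup_minus below_def less_Suc_eq_le)
    then show ?thesis by simp
  qed
  ultimately have "?Q (E_int n \<eta>)" unfolding E_int_def by (rule theI)
  then show "E_int n \<eta> \<in> mpols n" "tdeg (E_int n \<eta>) = weight \<eta>"
    "\<And>\<gamma>. \<gamma> \<in> compositions n \<Longrightarrow> \<gamma> \<noteq> \<eta> \<Longrightarrow> weight \<gamma> \<le> weight \<eta> \<Longrightarrow>
      evalp (E_int n \<eta>) (bar n \<gamma>) = 0" "lookup (E_int n \<eta>) \<eta> = 1"
    by blast+
qed

lemma partitions_subset_compositions: "partitions n \<subseteq> compositions n"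
  by (auto simp: partitions_def)

lemma sym_mpols_subset_mpols: "sym_mpols n \<subseteq> mpols n"
  by (auto simp: sym_mpols_def)

lemma sym_mpols_diff: "p \<in> sym_mpols n \<Longrightarrow> q \<in> sym_mpols n \<Longrightarrow> p - q \<in> sym_mpols n"
  using keys_diff[of p q] by (auto simp: sym_mpols_def mpols_def lookup_minus)

lemma sym_mpols_add: "p \<in> sym_mpols n \<Longrightarrow> q \<in> sym_mpols n \<Longrightarrow> p + q \<in> sym_mpols n"
  using keys_add[of p q] by (auto simp: sym_mpols_def mpols_def lookup_add)

lemma reflect_vars_sym_mpols: "p \<in> sym_mpols n \<Longrightarrow> reflect_vars p \<in> sym_mpols n"
  by (auto simp: sym_mpols_def mpols_def weight_map_key)

text \<open>The definite description is justified as for \<open>E_int\<close>, by symmetric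
  interpolation with \<open>Z = {\<kappa>}\<close>.\<close>

lemma P_int:
  assumes "\<kappa> \<in> partitions n"
  shows "P_int n \<kappa> \<in> sym_mpols n" and "tdeg (P_int n \<kappa>) = weight \<kappa>"
    and "\<And>\<mu>. \<mu> \<in> partitions n \<Longrightarrow> \<mu> \<noteq> \<kappa> \<Longrightarrow> weight \<mu> \<le> weight \<kappa> \<Longrightarrow>
      evalp (P_int n \<kappa>) (\<lambda>i. of_nat (lookup \<mu> i) + r_delta n i) = 0"
proof -
  let ?d = "Suc (weight \<kappa>)"
  let ?Q = "\<lambda>p. p \<in> sym_mpols n \<and> tdeg p = weight \<kappa> \<and>
     (\<forall>\<mu>\<in>partitions n. \<mu> \<noteq> \<kappa> \<and> weight \<mu> \<le> weight \<kappa> \<longrightarrow>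
        evalp p (\<lambda>i. of_nat (lookup \<mu> i) + r_delta n i) = 0) \<and>
     lookup p \<kappa> = 1"
  obtain p where p: "p \<in> sym_mpols n" "keys p \<subseteq> below n ?d"
    "\<And>\<mu>. \<mu> \<in> below n ?d \<inter> partitions n - {\<kappa>} \<Longrightarrow>
      evalp p (\<lambda>i. of_nat (lookup \<mu> i) + r_delta n i) = 0"
    "lookup p \<kappa> = 1"
    using sym_interpolation_exists[of "{\<kappa>}" ?d n "\<lambda>\<mu>. if \<mu> = \<kappa> then 1 else 0"] assms by auto
  have mp: "p \<in> mpols n" using p(1) sym_mpols_subset_mpols by blast
  have "evalp p (\<lambda>i. of_nat (lookup \<mu> i) + r_delta n i) = 0"
    if "\<mu> \<in> partitions n" "\<mu> \<noteq> \<kappa>" "weight \<mu> \<le> weight \<kappa>" for \<mu>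
    using that partitions_subset_compositions[of n] by (intro p(3)) (auto simp: below_def)
  then have "?Q p" using p(1,4) tdeg_eqI[OF mp p(2)] by simp
  moreover have "q = p" if Q: "?Q q" for q
  proof -
    have "q \<in> mpols n" using Q by (simp add: sym_mpols_def)
    then have "keys q \<subseteq> below n ?d" using Q keys_below_iff_tdeg[of q n "weight \<kappa>"] by simp
    then have keys: "keys (q - p) \<subseteq> below n ?d" using keys_diff[of q p] p(2) by blast
    have "q - p \<in> sym_mpols n" using Q p(1) sym_mpols_diff by blast
    then have "q - p = 0"
      using Q p(3,4)
      by (intro sym_interpolation_unique[OF _ _ keys, of "{\<kappa>}"])
        (simp_all add: evalp_diff lookup_minus below_def less_Suc_eq_le)
    then show ?thesis by simp
  qed
  ultimately have "?Q (P_int n \<kappa>)" unfolding P_int_def by (rule theI)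
  then show "P_int n \<kappa> \<in> sym_mpols n" "tdeg (P_int n \<kappa>) = weight \<kappa>"
    "\<And>\<mu>. \<mu> \<in> partitions n \<Longrightarrow> \<mu> \<noteq> \<kappa> \<Longrightarrow> weight \<mu> \<le> weight \<kappa> \<Longrightarrow>
      evalp (P_int n \<kappa>) (\<lambda>i. of_nat (lookup \<mu> i) + r_delta n i) = 0"
    by blast+
qed

section \<open>Characterising \<open>\<Xi>\<close> by vanishing\<close>

text \<open>The intended \<open>g\<close> is \<Xi>(f) for \<open>f\<close> homogeneous of degree
  \<open>d\<close>. Stated for arbitrary \<open>f\<close> and \<open>d\<close>, the relation is
  linear in the pair \<open>f\<close>, \<open>g\<close>.\<close>

definition vanishing_lift :: "nat \<Rightarrow> nat \<Rightarrow> mpol \<Rightarrow> mpol \<Rightarrow> bool" where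
  "vanishing_lift n d f g \<longleftrightarrow> keys (g - f) \<subseteq> below n d \<and>
     (\<forall>\<gamma>\<in>below n d. evalp g (\<lambda>i. - bar n \<gamma> i) = 0)"

text \<open>The difference of two lifts has degree below \<open>d\<close>; reflecting it turns the
  zeros \<open>- bar n \<gamma>\<close> into interpolation nodes.\<close>

lemma vanishing_lift_unique:
  assumes "vanishing_lift n d f g" "vanishing_lift n d f h"
  shows "g = h"
proof -
  have "keys (g - h) \<subseteq> keys (g - f) \<union> keys (h - f)"
    using keys_diff[of "g - f" "h - f"] by simp
  then have "keys (reflect_vars (g - h)) \<subseteq> below n d"
    using assms by (auto simp: vanishing_lift_def)
  then have "reflect_vars (g - h) = 0"
    using assms by (intro interpolation_unique[of "{}" d _ n])
      (auto simp: vanishing_lift_def evalp_reflect_vars evalp_diff)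
  then have "keys (g - h) = {}" by (metis keys_reflect_vars keys_zero)
  then show ?thesis by simp
qed

lemma interpolation_at_bar:
  "\<exists>p. keys p \<subseteq> below n d \<and> (\<forall>\<gamma>\<in>below n d. evalp p (bar n \<gamma>) = b \<gamma>)"
  using interpolation_exists[of "{}" d n b] by auto

text \<open>An interpolant of degree below \<open>d\<close>, reflected, cancels the values of
  \<open>f\<close> at the points \<open>- bar n \<gamma>\<close>.\<close>

lemma vanishing_lift_exists: "\<exists>g. vanishing_lift n d f g"
proof -
  obtain p where "keys p \<subseteq> below n d"
    "\<forall>\<gamma>\<in>below n d. evalp p (bar n \<gamma>) = - evalp f (\<lambda>i. - bar n \<gamma> i)"
    using interpolation_at_bar[of n d "\<lambda>\<gamma>. - evalp f (\<lambda>i. - bar n \<gamma> i)"] by blast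
  then show ?thesis
    by (intro exI[of _ "f + reflect_vars p"])
      (simp add: vanishing_lift_def evalp_add evalp_reflect_vars)
qed

lemma vanishing_lift_sum_scale:
  assumes "\<And>t. t \<in> S \<Longrightarrow> vanishing_lift n d (B t) (C t)"
  shows "vanishing_lift n d (\<Sum>t\<in>S. scale (c t) (B t)) (\<Sum>t\<in>S. scale (c t) (C t))"
proof -
  have "(\<Sum>t\<in>S. scale (c t) (C t)) - (\<Sum>t\<in>S. scale (c t) (B t)) = (\<Sum>t\<in>S. scale (c t) (C t - B t))"
    by (rule poly_mapping_eqI) (simp add: lookup_minus lookup_sum_scale algebra_simps sum_subtractf)
  moreover have "keys (\<Sum>t\<in>S. scale (c t) (C t - B t)) \<subseteq> below n d"
    using assms by (intro keys_sum_scale) (auto simp: vanishing_lift_def)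
  ultimately show ?thesis
    using assms by (simp add: vanishing_lift_def evalp_sum_scale)
qed

text \<open>The sign \<open>(-1) ^ d\<close> undoes the effect of the reflection on the part of
  degree \<open>d\<close>. This applies to both \<open>E_int\<close> and
  \<open>P_int\<close>.\<close>

lemma vanishing_lift_top_part:
  assumes p: "p \<in> mpols n" "tdeg p = d"
    and zero: "\<And>\<gamma>. \<gamma> \<in> below n d \<Longrightarrow> evalp p (bar n \<gamma>) = 0"
  shows "vanishing_lift n d (top_part p) (scale ((-1) ^ d) (reflect_vars p))"
proof -
  have "weight m \<le> d" if "lookup p m \<noteq> 0" for m
    using p(2) that unfolding tdeg_def by (auto simp: in_keys_iff intro!: Max_ge)
  then have "keys (scale ((-1) ^ d) (reflect_vars p) - top_part p) \<subseteq> below n d"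
    unfolding keys_below_iff using p
    by (auto simp: lookup_minus mem_mpols_iff order.order_iff_strict minus_one_power_iff
        split: if_splits)
  then show ?thesis
    using zero by (simp add: vanishing_lift_def evalp_scale evalp_reflect_vars)
qed

section \<open>The linear operator given by lifts of monomials\<close>

lemma mpol_expansion:
  "finite A \<Longrightarrow> keys p \<subseteq> A \<Longrightarrow> p = (\<Sum>m\<in>A. scale (lookup p m) (Poly_Mapping.single m 1))"
  by (rule poly_mapping_eqI)
    (auto simp: lookup_sum_scale lookup_single when_def if_distrib in_keys_iff cong: if_cong)

text \<open>The linear extension of the map sending \<open>x^m\<close> to its lift of order
  \<open>weight m\<close>. \<open>SOME\<close> selects the only such lift, by
  \<open>vanishing_lift_unique\<close>.\<close>

definition lift_operator :: "nat \<Rightarrow> mpol \<Rightarrow> mpol" where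
  "lift_operator n p = (\<Sum>m\<in>keys p. scale (lookup p m)
     (SOME g. vanishing_lift n (weight m) (Poly_Mapping.single m 1) g))"

lemma lift_operator_superset:
  assumes "finite A" "keys p \<subseteq> A"
  shows "lift_operator n p = (\<Sum>m\<in>A. scale (lookup p m)
     (SOME g. vanishing_lift n (weight m) (Poly_Mapping.single m 1) g))"
  unfolding lift_operator_def using assms
  by (intro sum.mono_neutral_left) (auto simp: in_keys_iff intro!: poly_mapping_eqI)

text \<open>All monomials of a homogeneous polynomial are lifted with the same \<open>d\<close>, so
  their lifts can be combined linearly.\<close>

lemma vanishing_lift_lift_operator:
  assumes "homogeneous d f"
  shows "vanishing_lift n d f (lift_operator n f)"
proof -
  have "vanishing_lift n d (\<Sum>m\<in>keys f. scale (lookup f m) (Poly_Mapping.single m 1))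
    (lift_operator n f)"
    unfolding lift_operator_def
  proof (rule vanishing_lift_sum_scale)
    fix m assume "m \<in> keys f"
    then have "weight m = d" using assms by (simp add: homogeneous_def)
    then show "vanishing_lift n d (Poly_Mapping.single m 1)
        (SOME g. vanishing_lift n (weight m) (Poly_Mapping.single m 1) g)"
      using someI_ex[OF vanishing_lift_exists] by simp
  qed
  then show ?thesis by (simp flip: mpol_expansion[OF finite_keys order.refl])
qed

lemma mpols_sum_scale:
  "(\<And>t. t \<in> S \<Longrightarrow> B t \<in> mpols n) \<Longrightarrow> (\<Sum>t\<in>S. scale (c t) (B t)) \<in> mpols n"
  using keys_sum_scale[of S B "compositions n" c] by (simp add: mpols_def)

lemma mpols_add: "p \<in> mpols n \<Longrightarrow> q \<in> mpols n \<Longrightarrow> p + q \<in> mpols n"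
  using keys_add[of p q] by (auto simp: mpols_def)

lemma mpols_scale: "p \<in> mpols n \<Longrightarrow> scale c p \<in> mpols n"
  using keys_scale[of c p] by (auto simp: mpols_def)

lemma single_in_mpols: "m \<in> compositions n \<Longrightarrow> Poly_Mapping.single m c \<in> mpols n"
  by (simp add: mpols_def)

lemma vanishing_lift_mpols:
  assumes "vanishing_lift n d f g" "f \<in> mpols n"
  shows "g \<in> mpols n"
proof -
  have "keys g \<subseteq> keys (g - f) \<union> keys f" using keys_add[of "g - f" f] by simp
  then show ?thesis using assms by (auto simp: vanishing_lift_def mpols_def below_def)
qed

lemma linear_operator_lift_operator: "linear_operator n (lift_operator n)"
  unfolding linear_operator_def
proof (intro conjI ballI allI funcsetI)
  fix p assume p: "p \<in> mpols n"
  show "lift_operator n p \<in> mpols n"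
    unfolding lift_operator_def
  proof (rule mpols_sum_scale)
    fix m assume "m \<in> keys p"
    then have "Poly_Mapping.single m 1 \<in> mpols n" using p by (intro single_in_mpols) (auto simp: mpols_def)
    then show "(SOME g. vanishing_lift n (weight m) (Poly_Mapping.single m 1) g) \<in> mpols n"
      using vanishing_lift_mpols someI_ex[OF vanishing_lift_exists] by blast
  qed
next
  fix p q :: mpol
  have "finite (keys p \<union> keys q)" by simp
  note e = lift_operator_superset[OF this]
  show "lift_operator n (p + q) = lift_operator n p + lift_operator n q"
    using keys_add[of p q]
    by (subst (1 2 3) e) (auto simp: lookup_sum_scale lookup_add algebra_simps sum.distrib
      intro!: poly_mapping_eqI)
next
  fix c p
  show "lift_operator n (scale c p) = scale c (lift_operator n p)"
    using keys_scale[of c p]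
    by (subst (1 2) lift_operator_superset[of "keys p"])
      (auto simp: lookup_sum_scale sum_distrib_left mult.assoc intro!: poly_mapping_eqI)
qed

lemma linear_operator_sum_scale:
  assumes T: "linear_operator n T" and "finite S" "\<And>t. t \<in> S \<Longrightarrow> B t \<in> mpols n"
  shows "T (\<Sum>t\<in>S. scale (c t) (B t)) = (\<Sum>t\<in>S. scale (c t) (T (B t)))"
  using assms(2,3)
proof (induction S rule: finite_induct)
  case empty
  have "scale 0 p = 0" for p by (rule poly_mapping_eqI) simp
  moreover have "(0 :: mpol) \<in> mpols n" by (simp add: mpols_def)
  ultimately have "T 0 = 0" using T unfolding linear_operator_def by metis
  then show ?case by simp
next
  case (insert t S)
  have "scale (c t) (B t) \<in> mpols n"
    using insert.prems by (intro mpols_scale) auto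
  moreover have "(\<Sum>t\<in>S. scale (c t) (B t)) \<in> mpols n"
    using insert.prems by (intro mpols_sum_scale) auto
  ultimately show ?case using T insert by (simp add: linear_operator_def)
qed

section \<open>The polynomials \<open>F_top\<close>: their images and their span\<close>

lemma E_top_homogeneous: "\<eta> \<in> compositions n \<Longrightarrow> homogeneous (weight \<eta>) (E_top n \<eta>)"
  by (auto simp: homogeneous_def E_top_def in_keys_iff E_int split: if_splits)

lemma top_part_mpols: "p \<in> mpols n \<Longrightarrow> top_part p \<in> mpols n"
  by (auto simp: mem_mpols_iff)

lemma F_top_mpols: "\<eta> \<in> compositions n \<Longrightarrow> F_top n \<eta> \<in> mpols n"
  unfolding F_top_def E_top_def by (intro mpols_scale top_part_mpols E_int(1))

lemma scale_scale: "scale a (scale b p) = scale (a * b) p"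
  by (rule poly_mapping_eqI) (simp add: mult.assoc)

text \<open>Up to sign, the reflected \<open>E_int\<close> is a lift of \<open>E_top\<close>, hence
  the lift; both sides are then scaled by \<open>d_factor\<close>.\<close>

lemma lift_operator_F_top:
  assumes "\<eta> \<in> compositions n"
  shows "lift_operator n (F_top n \<eta>) = F_int n \<eta>"
proof -
  have "vanishing_lift n (weight \<eta>) (E_top n \<eta>)
      (scale ((-1) ^ weight \<eta>) (reflect_vars (E_int n \<eta>)))"
    unfolding E_top_def
  proof (rule vanishing_lift_top_part[OF E_int(1,2)[OF assms]])
    show "evalp (E_int n \<eta>) (bar n \<gamma>) = 0" if "\<gamma> \<in> below n (weight \<eta>)" for \<gamma>
      using that by (intro E_int(3)[OF assms]) (auto simp: below_def)
  qed
  then have "lift_operator n (E_top n \<eta>) = scale ((-1) ^ weight \<eta>) (reflect_vars (E_int n \<eta>))"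
    by (rule vanishing_lift_unique[OF vanishing_lift_lift_operator[OF E_top_homogeneous[OF assms]]])
  moreover have "E_top n \<eta> \<in> mpols n"
    unfolding E_top_def by (rule top_part_mpols[OF E_int(1)[OF assms]])
  ultimately show ?thesis
    using linear_operator_lift_operator[of n]
    by (simp add: linear_operator_def F_top_def F_int_def scale_scale mult.commute)
qed

text \<open>A factor multiplied by \<open>r\<close> becomes \<open>(a + 1) + r * (l + 1)\<close>, a
  polynomial whose value \<open>a + 1\<close> at \<open>r = 0\<close> is nonzero.\<close>

lemma d_factor_nonzero: "d_factor n \<eta> \<noteq> 0"
proof -
  have "\<alpha> * of_nat (a + 1) + of_nat l + 1 \<noteq> 0" for a l :: nat
  proof
    have r: "r \<noteq> 0" by (simp add: r_def Zero_fract_def eq_fract)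
    assume "\<alpha> * of_nat (a + 1) + of_nat l + 1 = 0"
    moreover have "r * (\<alpha> * x + y + 1) = (r * \<alpha>) * x + r * (y + 1)" for x y
      by (simp add: algebra_simps)
    ultimately have "r * \<alpha> * of_nat (a + 1) + r * (of_nat l + 1) = 0" by (metis mult_zero_right)
    then have "of_nat (a + 1) + r * of_nat (l + 1) = 0"
      using r by (simp add: \<alpha>_def add.commute)
    then have "to_fract (of_nat (a + 1) + [:0, 1:] * of_nat (l + 1) :: rat poly) = 0"
      by (simp only: to_fract_add to_fract_mult to_fract_of_nat) (simp add: to_fract_def r_def)
    then have "poly (of_nat (a + 1) + [:0, 1:] * of_nat (l + 1) :: rat poly) 0 = 0"
      by (simp only: to_fract_eq_0_iff poly_0)
    then show False by (simp add: poly_of_nat del: of_nat_Suc of_nat_add)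
  qed
  moreover have "finite (boxes n \<eta>)" by (simp add: boxes_def)
  ultimately show ?thesis unfolding d_factor_def by (auto simp: prod_zero_iff)
qed

text \<open>Otherwise \<open>E_int\<close> would vanish at all nodes of weight at most that of
  \<eta>, hence be zero, against its coefficient 1.\<close>

lemma E_int_bar_nonzero:
  assumes "\<eta> \<in> compositions n"
  shows "evalp (E_int n \<eta>) (bar n \<eta>) \<noteq> 0"
proof
  assume zero: "evalp (E_int n \<eta>) (bar n \<eta>) = 0"
  have "keys (E_int n \<eta>) \<subseteq> below n (Suc (weight \<eta>))"
    using E_int(1,2)[OF assms] keys_below_iff_tdeg[of "E_int n \<eta>" n "weight \<eta>"] by simp
  then have "E_int n \<eta> = 0"
  proof (rule interpolation_unique[of "{}", rotated])
    fix \<gamma> assume "\<gamma> \<in> below n (Suc (weight \<eta>)) - {}"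
    then show "evalp (E_int n \<eta>) (bar n \<gamma>) = 0"
      using zero E_int(3)[OF assms, of \<gamma>] by (cases "\<gamma> = \<eta>") (auto simp: below_def)
  qed auto
  then show False using E_int(4)[OF assms] by simp
qed

text \<open>Lower terms are added to \<open>x^m\<close> until the result \<open>g\<close> vanishes
  at all nodes of smaller weight. Then \<open>g\<close> is a combination of the \<open>E_int\<close>
  of the same weight, and top parts are compared.\<close>

lemma F_top_spans:
  assumes m: "m \<in> compositions n"
  shows "\<exists>S c. finite S \<and> S \<subseteq> compositions n \<and>
    Poly_Mapping.single m 1 = (\<Sum>\<eta>\<in>S. scale (c \<eta>) (F_top n \<eta>))"
proof -
  let ?d = "weight m"
  define S where "S = {\<eta> \<in> compositions n. weight \<eta> = ?d}"
  have "S \<subseteq> below n (Suc ?d)" by (auto simp: S_def below_def)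
  then have S: "finite S" "S \<subseteq> compositions n"
    by (auto simp: S_def intro: finite_subset)
  obtain p where p: "keys p \<subseteq> below n ?d"
    "\<And>\<gamma>. \<gamma> \<in> below n ?d \<Longrightarrow> evalp p (bar n \<gamma>) = - evalp (Poly_Mapping.single m 1) (bar n \<gamma>)"
    using interpolation_at_bar[of n ?d "\<lambda>\<gamma>. - evalp (Poly_Mapping.single m 1) (bar n \<gamma>)"]
    by blast
  define g where "g = Poly_Mapping.single m 1 + p"
  have g0: "evalp g (bar n \<gamma>) = 0" if "\<gamma> \<in> below n ?d" for \<gamma>
    using p(2)[OF that] by (simp add: g_def evalp_add)
  have keys_g: "keys g \<subseteq> below n (Suc ?d)"
    using keys_add[of "Poly_Mapping.single m 1" p] p(1) m
    by (auto simp: g_def below_def subset_iff)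
  \<comment> \<open>Lagrange coefficients: among the nodes of weight at most \<open>?d\<close>,
    \<open>E_int n \<eta>\<close> is nonzero only at \<open>bar n \<eta>\<close>.\<close>
  define e where "e \<eta> = evalp g (bar n \<eta>) / evalp (E_int n \<eta>) (bar n \<eta>)" for \<eta>
  define h where "h = (\<Sum>\<eta>\<in>S. scale (e \<eta>) (E_int n \<eta>))"
  have keys_h: "keys h \<subseteq> below n (Suc ?d)"
    unfolding h_def
  proof (rule keys_sum_scale)
    fix \<eta> assume "\<eta> \<in> S"
    then show "keys (E_int n \<eta>) \<subseteq> below n (Suc ?d)"
      using E_int(1,2) keys_below_iff_tdeg by (auto simp: S_def)
  qed
  have "g - h = 0"
  proof (rule interpolation_unique[of "{}"])
    show "keys (g - h) \<subseteq> below n (Suc ?d)" using keys_diff[of g h] keys_g keys_h by blast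
    fix \<gamma> assume "\<gamma> \<in> below n (Suc ?d) - {}"
    then have \<gamma>: "\<gamma> \<in> compositions n" "weight \<gamma> \<le> ?d" by (auto simp: below_def)
    have zero: "evalp (E_int n \<eta>) (bar n \<gamma>) = 0" if "\<eta> \<in> S" "\<eta> \<noteq> \<gamma>" for \<eta>
      using that \<gamma> by (intro E_int(3)) (auto simp: S_def)
    have h: "evalp h (bar n \<gamma>) = (\<Sum>\<eta>\<in>S. e \<eta> * evalp (E_int n \<eta>) (bar n \<gamma>))"
      by (simp add: h_def evalp_sum_scale)
    show "evalp (g - h) (bar n \<gamma>) = 0"
    proof (cases "\<gamma> \<in> S")
      case True
      then have "evalp h (bar n \<gamma>) = e \<gamma> * evalp (E_int n \<gamma>) (bar n \<gamma>)"
        unfolding h using S(1) zero by (subst sum.remove[of _ \<gamma>]) (auto intro!: sum.neutral)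
      then show ?thesis using E_int_bar_nonzero[OF \<gamma>(1)] by (simp add: evalp_diff e_def)
    next
      case False
      then have "evalp h (bar n \<gamma>) = 0"
        unfolding h using zero by (intro sum.neutral) auto
      moreover have "evalp g (bar n \<gamma>) = 0"
        using False \<gamma> by (intro g0) (auto simp: S_def below_def)
      ultimately show ?thesis by (simp add: evalp_diff)
    qed
  qed auto
  then have gh: "g = h" by simp
  have "Poly_Mapping.single m 1 = (\<Sum>\<eta>\<in>S. scale (e \<eta> / d_factor n \<eta>) (F_top n \<eta>))"
  proof (rule poly_mapping_eqI)
    fix k
    have "lookup (\<Sum>\<eta>\<in>S. scale (e \<eta> / d_factor n \<eta>) (F_top n \<eta>)) k =
        (\<Sum>\<eta>\<in>S. e \<eta> * lookup (E_top n \<eta>) k)"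
      by (simp add: lookup_sum_scale F_top_def d_factor_nonzero)
    also have "\<dots> = (\<Sum>\<eta>\<in>S. if weight k = ?d then e \<eta> * lookup (E_int n \<eta>) k else 0)"
      by (intro sum.cong refl) (auto simp: E_top_def S_def E_int(2))
    also have "\<dots> = (if weight k = ?d then lookup h k else 0)"
      by (simp add: h_def lookup_sum_scale)
    \<comment> \<open>Since \<open>p\<close> has degree below \<open>?d\<close>, the part of
      \<open>g = h\<close> of degree \<open>?d\<close> is just \<open>x^m\<close>.\<close>
    also have "\<dots> = lookup (Poly_Mapping.single m 1) k"
    proof (cases "weight k = ?d")
      case True
      then have "k \<notin> keys p" using p(1) by (auto simp: below_def)
      then show ?thesis using True
        by (simp add: gh[symmetric] g_def lookup_add in_keys_iff)
    qed (auto simp: lookup_single when_def)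
    finally show "lookup (Poly_Mapping.single m 1) k =
        lookup (\<Sum>\<eta>\<in>S. scale (e \<eta> / d_factor n \<eta>) (F_top n \<eta>)) k" by simp
  qed
  with S show ?thesis
    by (intro exI[of _ S] exI[of _ "\<lambda>\<eta>. e \<eta> / d_factor n \<eta>"] conjI)
qed

section \<open>Identification of \<Xi> with the lift operator\<close>

lemma linear_operators_agree:
  assumes T: "linear_operator n T" and U: "linear_operator n U"
    and eq: "\<And>\<eta>. \<eta> \<in> compositions n \<Longrightarrow> T (F_top n \<eta>) = U (F_top n \<eta>)"
    and p: "p \<in> mpols n"
  shows "T p = U p"
proof -
  have single: "T (Poly_Mapping.single m 1) = U (Poly_Mapping.single m 1)" if m: "m \<in> compositions n" for m
  proof -
    obtain S c where S: "finite S" "S \<subseteq> compositions n"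
      and c: "Poly_Mapping.single m 1 = (\<Sum>\<eta>\<in>S. scale (c \<eta>) (F_top n \<eta>))"
      using F_top_spans[OF m] by blast
    have expand: "V (Poly_Mapping.single m 1) = (\<Sum>\<eta>\<in>S. scale (c \<eta>) (V (F_top n \<eta>)))"
      if "linear_operator n V" for V
      unfolding c using S F_top_mpols by (intro linear_operator_sum_scale[OF that]) auto
    show ?thesis using eq S by (simp add: expand[OF T] expand[OF U] subset_iff)
  qed
  have keys: "keys p \<subseteq> compositions n" using p by (simp add: mpols_def)
  have expand: "V p = (\<Sum>m\<in>keys p. scale (lookup p m) (V (Poly_Mapping.single m 1)))"
    if "linear_operator n V" for V
    by (subst mpol_expansion[OF finite_keys order.refl, of p])
      (use keys in \<open>intro linear_operator_sum_scale[OF that] single_in_mpols; auto\<close>)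
  show ?thesis using single keys by (simp add: expand[OF T] expand[OF U] subset_iff)
qed

text \<open>The lift operator has the required values on \<open>F_top\<close>, and these span. It is
  restricted to \<open>mpols n\<close> to meet the extensionality clause.\<close>

lemma Xi_eq_lift_operator:
  assumes "p \<in> mpols n"
  shows "Xi n p = lift_operator n p"
proof -
  let ?T = "restrict (lift_operator n) (mpols n)"
  let ?Q = "\<lambda>T. T \<in> extensional (mpols n) \<and> linear_operator n T \<and>
     (\<forall>\<eta>\<in>compositions n. T (F_top n \<eta>) = F_int n \<eta>)"
  have lin: "linear_operator n ?T"
    using linear_operator_lift_operator[of n]
    by (simp add: linear_operator_def Pi_iff mpols_add mpols_scale)
  have "Xi n = ?T"
    unfolding Xi_def
  proof (rule the_equality)
    show "?Q ?T" using lin lift_operator_F_top F_top_mpols by simp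
    fix U assume U: "?Q U"
    show "U = ?T"
    proof (rule extensionalityI[of _ "mpols n"])
      fix q assume "q \<in> mpols n"
      then show "U q = ?T q"
        using linear_operators_agree[of n U ?T] U lin lift_operator_F_top F_top_mpols by simp
    qed (use U in auto)
  qed
  then show ?thesis using assms by simp
qed

lemma linear_operator_Xi: "linear_operator n (Xi n)"
  using linear_operator_lift_operator[of n]
  by (simp add: linear_operator_def Pi_iff Xi_eq_lift_operator mpols_add mpols_scale)

text \<open>From here on \<Xi> is computed by exhibiting a lift.\<close>

lemma Xi_eqI:
  assumes "f \<in> mpols n" "homogeneous d f" "vanishing_lift n d f g"
  shows "g = Xi n f"
  unfolding Xi_eq_lift_operator[OF assms(1)]
  by (rule vanishing_lift_unique[OF assms(3) vanishing_lift_lift_operator[OF assms(2)]])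

section \<open>Symmetric polynomials\<close>

text \<open>By symmetry, zeros at the points of partitions spread to all rearrangements, and these
  include every \<open>- bar n \<gamma>\<close>.\<close>

lemma sym_vanishing_lift:
  assumes g: "g \<in> sym_mpols n" "keys (g - f) \<subseteq> below n d"
    and zero: "\<And>\<mu>. \<mu> \<in> partitions n \<Longrightarrow> weight \<mu> < d \<Longrightarrow>
      evalp g (\<lambda>i. - of_nat (lookup \<mu> i) - r_delta n i) = 0"
  shows "vanishing_lift n d f g"
proof -
  have "evalp g (\<lambda>i. - bar n \<gamma> i) = 0" if "\<gamma> \<in> below n d" for \<gamma>
  proof -
    have \<gamma>: "\<gamma> \<in> compositions n" "weight \<gamma> < d" using that by (auto simp: below_def)
    then show ?thesis
      using zero[OF sort_perm(2)[OF \<gamma>(1)]] evalp_bar_sym[OF g(1) \<gamma>(1), of uminus]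
      by (simp add: weight_map_key[OF sort_perm(1)[OF \<gamma>(1)]])
  qed
  then show ?thesis using g(2) by (simp add: vanishing_lift_def)
qed

lemma sym_vanishing_lift_exists:
  assumes "f \<in> sym_mpols n"
  shows "\<exists>g\<in>sym_mpols n. keys (g - f) \<subseteq> below n d \<and>
    (\<forall>\<mu>\<in>partitions n. weight \<mu> < d \<longrightarrow>
      evalp g (\<lambda>i. - of_nat (lookup \<mu> i) - r_delta n i) = 0)"
proof -
  define b where "b \<mu> = - evalp f (\<lambda>i. - of_nat (lookup \<mu> i) - r_delta n i)" for \<mu>
  obtain p where p: "p \<in> sym_mpols n" "keys p \<subseteq> below n d"
    "\<And>\<mu>. \<mu> \<in> below n d \<inter> partitions n \<Longrightarrow>
      evalp p (\<lambda>i. of_nat (lookup \<mu> i) + r_delta n i) = b \<mu>"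
    using sym_interpolation_exists[of "{}" d n b] by auto
  have "evalp (f + reflect_vars p) (\<lambda>i. - of_nat (lookup \<mu> i) - r_delta n i) = 0"
    if "\<mu> \<in> partitions n" "weight \<mu> < d" for \<mu>
    using p(3)[of \<mu>] that partitions_subset_compositions[of n]
    by (auto simp: evalp_add evalp_reflect_vars b_def below_def add.commute)
  moreover have "f + reflect_vars p \<in> sym_mpols n"
    using assms p(1) by (intro sym_mpols_add reflect_vars_sym_mpols)
  ultimately show ?thesis using p(2) by (intro bexI[of _ "f + reflect_vars p"]) auto
qed

text \<open>Symmetric interpolation yields a symmetric lift, which must be \<Xi>(f) because lifts
  are unique.\<close>

lemma Xi_homogeneous_sym:
  assumes "f \<in> sym_mpols n" "homogeneous d f"
  shows "Xi n f \<in> sym_mpols n" "keys (Xi n f - f) \<subseteq> below n d"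
    and "\<And>\<mu>. \<mu> \<in> partitions n \<Longrightarrow> weight \<mu> < d \<Longrightarrow>
      evalp (Xi n f) (\<lambda>i. - of_nat (lookup \<mu> i) - r_delta n i) = 0"
proof -
  obtain g where g: "g \<in> sym_mpols n" "keys (g - f) \<subseteq> below n d"
    "\<And>\<mu>. \<mu> \<in> partitions n \<Longrightarrow> weight \<mu> < d \<Longrightarrow>
      evalp g (\<lambda>i. - of_nat (lookup \<mu> i) - r_delta n i) = 0"
    using sym_vanishing_lift_exists[OF assms(1)] by blast
  have "f \<in> mpols n" using assms(1) sym_mpols_subset_mpols by blast
  then have "g = Xi n f" using assms(2) sym_vanishing_lift[OF g] by (rule Xi_eqI)
  then show "Xi n f \<in> sym_mpols n" "keys (Xi n f - f) \<subseteq> below n d"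
    "\<And>\<mu>. \<mu> \<in> partitions n \<Longrightarrow> weight \<mu> < d \<Longrightarrow>
      evalp (Xi n f) (\<lambda>i. - of_nat (lookup \<mu> i) - r_delta n i) = 0"
    using g by simp_all
qed

text \<open>Permuting exponents preserves weight, so the homogeneous components \<open>H d\<close>
  are symmetric and can be treated one by one.\<close>

lemma Xi_sym:
  assumes f: "f \<in> sym_mpols n"
  shows "Xi n f \<in> sym_mpols n"
proof -
  define H where
    "H d = (\<Sum>m\<in>{m \<in> keys f. weight m = d}. Poly_Mapping.single m (lookup f m))" for d
  have H: "lookup (H d) m = (if weight m = d then lookup f m else 0)" for d m
    unfolding H_def lookup_sum lookup_single
    by (cases "m \<in> keys f") (auto simp: when_def in_keys_iff)
  have Hsym: "H d \<in> sym_mpols n" for d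
    using f by (auto simp: sym_mpols_def mem_mpols_iff H weight_map_key)
  have Hhom: "homogeneous d (H d)" for d
    by (auto simp: homogeneous_def in_keys_iff H split: if_splits)
  have "f = (\<Sum>d\<in>weight ` keys f. scale 1 (H d))"
    by (rule poly_mapping_eqI) (auto simp: lookup_sum_scale H in_keys_iff image_iff)
  then have "Xi n f = (\<Sum>d\<in>weight ` keys f. scale 1 (Xi n (H d)))"
    using linear_operator_sum_scale[OF linear_operator_Xi, of "weight ` keys f" H n "\<lambda>_. 1"]
      Hsym sym_mpols_subset_mpols by auto
  also have "\<dots> \<in> sym_mpols n"
    by (rule sym_mpols_sum_scale) (rule Xi_homogeneous_sym(1)[OF Hsym Hhom])
  finally show ?thesis .
qed

lemma Xi_J_jack:
  assumes \<kappa>: "\<kappa> \<in> partitions n"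
  shows "Xi n (J_jack n \<kappa>) = J_int n \<kappa>"
proof -
  note P = P_int[OF \<kappa>]
  have mp: "P_int n \<kappa> \<in> mpols n" using P(1) sym_mpols_subset_mpols by blast
  have "evalp (P_int n \<kappa>) (bar n \<gamma>) = 0" if "\<gamma> \<in> below n (weight \<kappa>)" for \<gamma>
  proof -
    have \<gamma>: "\<gamma> \<in> compositions n" "weight \<gamma> < weight \<kappa>" using that by (auto simp: below_def)
    have w: "weight (Poly_Mapping.map_key (sort_perm n \<gamma>) \<gamma>) < weight \<kappa>"
      using \<gamma> by (simp add: weight_map_key[OF sort_perm(1)])
    \<comment> \<open>The one partition of weight at most \<open>weight \<kappa>\<close> where
      \<open>P_int\<close> need not vanish is \<kappa> itself, and it is too heavy to occur
      here.\<close>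
    then have "Poly_Mapping.map_key (sort_perm n \<gamma>) \<gamma> \<noteq> \<kappa>" by auto
    then show ?thesis
      using evalp_bar_sym[OF P(1) \<gamma>(1), of "\<lambda>x. x"] P(3)[OF sort_perm(2)[OF \<gamma>(1)]] w by simp
  qed
  then have "vanishing_lift n (weight \<kappa>) (P_jack n \<kappa>)
      (scale ((-1) ^ weight \<kappa>) (reflect_vars (P_int n \<kappa>)))"
    unfolding P_jack_def using mp P(2) by (intro vanishing_lift_top_part)
  note lift = this
  have Pm: "P_jack n \<kappa> \<in> mpols n" unfolding P_jack_def by (rule top_part_mpols[OF mp])
  have "homogeneous (weight \<kappa>) (P_jack n \<kappa>)"
    by (auto simp: homogeneous_def P_jack_def in_keys_iff P(2) split: if_splits)
  note Xi_eqI[OF Pm this lift, symmetric]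
  then show ?thesis
    using linear_operator_Xi[of n] Pm
    by (simp add: linear_operator_def J_jack_def J_int_def scale_scale mult.commute)
qed

theorem theorem3p9:
  fixes n :: nat
  assumes "n \<ge> 1"
  shows "(\<forall>f\<in>sym_mpols n. Xi n f \<in> sym_mpols n) \<and>
    (\<forall>\<kappa>\<in>partitions n. Xi n (J_jack n \<kappa>) = J_int n \<kappa>) \<and>
    (\<forall>d. \<forall>f\<in>sym_mpols n. homogeneous d f \<longrightarrow>
      (\<forall>g\<in>mpols n.
        (g \<in> sym_mpols n \<and>
         deg_less (g - f) d \<and>
         (\<forall>\<mu>\<in>partitions n. weight \<mu> < d \<longrightarrow>
            evalp g (\<lambda>i. - of_nat (lookup \<mu> i) - r_delta n i) = 0))
        \<longleftrightarrow> g = Xi n f))"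
proof (intro conjI allI ballI impI)
  fix d f g
  assume f: "f \<in> sym_mpols n" "homogeneous d f" and g: "g \<in> mpols n"
  have f': "f \<in> mpols n" using f(1) sym_mpols_subset_mpols by blast
  have deg: "deg_less (g - f) d \<longleftrightarrow> keys (g - f) \<subseteq> below n d"
    using keys_diff[of g f] f' g by (intro keys_below_iff_deg_less[symmetric]) (auto simp: mpols_def)
  show "(g \<in> sym_mpols n \<and> deg_less (g - f) d \<and>
      (\<forall>\<mu>\<in>partitions n. weight \<mu> < d \<longrightarrow>
        evalp g (\<lambda>i. - of_nat (lookup \<mu> i) - r_delta n i) = 0)) \<longleftrightarrow> g = Xi n f"
    \<comment> \<open>A \<open>g\<close> with the three properties is a lift of \<open>f\<close>,
      hence \<Xi>(f); conversely \<Xi>(f) has them.\<close>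
    unfolding deg using Xi_eqI[OF f' f(2) sym_vanishing_lift] Xi_homogeneous_sym[OF f] by blast
qed (rule Xi_sym Xi_J_jack; assumption)+

end
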